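(* Let $(S_n(\omega))_{n=0}^\infty$ be a Sheffer sequence over $V$ with generating function $$\sum_{n=0}^\infty\frac1{n!}\langle S_n(\omega),v^{\otimes n}\rangle=\exp\big[\langle\omega,B(v)\rangle+\alpha(v)\big],\quad\omega\in V^*,$$ where $B(v)=\sum_{k=1}^\infty B_kv^{\otimes k}\in\mathcal F_1(V)$ and $\alpha(v)=\sum_{k=1}^\infty\langle\alpha_k,v^{\otimes k}\rangle\in\mathcal F(V,\mathbb F)$, and let $L(v)=B^{\langle-1\rangle}(v)$ be the compositional inverse of $B(v)$. For $\zeta\in V$, let $R(\zeta)\in\mathcal L(\mathcal P(V^* ))$ be the raising operator corresponding to $(S_n(\omega))_{n=0}^\infty$, i.e., the linear operator with $$\big(R(\zeta)\langle S_n(\cdot),f_n\rangle\big)(\omega)=\langle S_{n+1}(\omega),f_n\odot\zeta\rangle,\quad f_n\in V^{\odot n},\ n\in\mathbb N_0,$$ and set $$\Phi_\zeta(v):=B'(L(v);\zeta)\in\mathcal F(V,V),\qquad\Gamma_\zeta(v):=\alpha'(L(v);\zeta)\in\mathcal F(V,\mathbb F).$$ Then, for each $\zeta\in V$, $p\in\mathcal P(V^* )$ and $\omega\in V^*$, $$\big(R(\zeta)p\big)(\omega)=\big\langle\omega,(\Phi_\zeta(D)p)(\omega)\big\rangle+(\Gamma_\zeta(D)p)(\omega).$$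
   Context: $\mathbb F=\mathbb R$ or $\mathbb C$; $V$ is a vector space over $\mathbb F$ (of any dimension); $V^*$ is its algebraic dual; $\langle\cdot,\cdot\rangle$ denotes the dual pairing (also between $(V^{\odot n})^*$ and $V^{\odot n}$). $\mathbb N=\{1,2,\dots\}$, $\mathbb N_0=\mathbb N\cup\{0\}$. $\mathcal L(U,W)$ is the space of linear operators, $\mathcal L(U)=\mathcal L(U,U)$. $V^{\odot n}$ is the $n$th algebraic symmetric tensor power of $V$, the linear span of the vectors $v_1\odot\dots\odot v_n=\frac1{n!}\sum_{\pi\in S_n}v_{\pi(1)}\otimes\dots\otimes v_{\pi(n)}$ (equivalently, of the vectors $v^{\otimes n}$); $V^{\odot0}=\mathbb F$, $v^{\otimes0}=1$. $\odot$ also denotes the induced bilinear symmetric product $V^{\odot m}\times V^{\odot n}\to V^{\odot(m+n)}$. For $\omega\in V^*$, $\langle\omega^{\otimes n},v_1\odot\dots\odot v_n\rangle=\prod_i\langle\omega,v_i\rangle$, $\omega^{\otimes 0}=1$. For linear operators (or functionals) $A_i$ on $V^{\odot l_i}$, $m=l_1+\dots+l_n$, $(A_1\odot\dots\odot A_n)v^{\otimes m}=(A_1v^{\otimes l_1})\odot\dots\odot(A_nv^{\otimes l_n})$. Polynomials: $\mathcal P(V^* )$ is the space of functions $p:V^*\to\mathbb F$, $p(\omega)=\sum_{k=0}^n\langle\omega^{\otimes k},f_k\rangle$, $f_k\in V^{\odot k}$. $\mathcal P(V^*,W)$ is the linear span of the functions $\omega\mapsto p(\omega)w$, $p\in\mathcal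 P(V^* )$, $w\in W$. A polynomial sequence over $V$ is a sequence of maps $\omega\mapsto S_n(\omega)\in(V^{\odot n})^*$, $n\in\mathbb N_0$, with $\langle S_n(\omega),f_n\rangle=\sum_{k=0}^n\langle\omega^{\otimes k},S_{kn}f_n\rangle$, $f_n\in V^{\odot n}$, $S_{kn}\in\mathcal L(V^{\odot n},V^{\odot k})$, each $S_{nn}$ bijective. It is a Sheffer sequence if its generating function $\sum_n\frac1{n!}\langle S_n(\omega),v^{\otimes n}\rangle$ equals $\exp[\langle\omega,B(v)\rangle]A(v)$ with $B(v)\in\mathcal F_1(V)$, $A(v)\in\mathcal F(V,\mathbb F)$, $A(0)\ne0$; when $A(0)=1$ one sets $\alpha(v)=\log A(v)$, giving the form in the claim. $D^k\in\mathcal L(\mathcal P(V^* ),\mathcal P(V^*,V^{\odot k}))$ is determined by $(D^k\langle\cdot^{\otimes n},v^{\otimes n}\rangle)(\omega)=n(n-1)\dotsm(n-k+1)\langle\omega,v\rangle^{n-k}v^{\otimes k}$ (zero if $k>n$). For a formal tensor power series $G(v)=G_0+\sum_{k\ge1}G_kv^{\otimes k}\in\mathcal F(V,W)$ (with $W=V$ or $W=\mathbb F$), the operator $G(D)\in\mathcal L(\mathcal P(V^* ),\mathcal P(V^*,W))$ is $(G(D)p)(\omega)=p(\omega)G_0+\sum_{k\ge1}G_k\big((D^kp)(\omega)\big)$ (a finite sum for each $p$). Formal tensor power series: $\mathcal F(V,W)$ is the set of formal series $A(v)=A_0+\sum_{n\ge1}A_nv^{\otimes n}$ with $A_0\in W$,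 $A_n\in\mathcal L(V^{\odot n},W)$, identified with the coefficient sequence; for $W=\mathbb F$ one writes $\langle A_n,v^{\otimes n}\rangle$. Products in $\mathcal F(V,\mathbb F)$ have $n$th coefficient $\sum_{k=0}^nA^{(1)}_k\odot A^{(2)}_{n-k}$; $\langle\omega,B(v)\rangle=\sum_n\langle\omega,B_nv^{\otimes n}\rangle$; $\exp[C(v)]=\sum_{k\ge0}\frac1{k!}C(v)^k$ when $C(0)=0$. For $A(v)\in\mathcal F(V,W)$ and $B(v)\in\mathcal F(V,V)$ with $B(0)=0$, the composition $A(B(v))\in\mathcal F(V,W)$ has zeroth coefficient $A_0$ and $n$th coefficient $\sum_{m=1}^nA_m\sum_{i_1,\dots,i_m\ge1,\,i_1+\dots+i_m=n}B_{i_1}\odot\dots\odot B_{i_m}$. $\mathcal F_1(V)$ is the set of $B(v)\in\mathcal F(V,V)$ with $B(0)=0$ and $B_1$ invertible, a group under composition with identity $v$. The derivative of $A(v)\in\mathcal F(V,W)$ in direction $\zeta\in V$ is $A'(v;\zeta)=\sum_{n\ge1}nA_n(v^{\otimes(n-1)}\odot\zeta)\in\mathcal F(V,W)$; $A'(L(v);\zeta)$ denotes the composition of the series $A'(v;\zeta)$ with $L(v)$. *)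

theory Defs
  imports Complex_Main "HOL-Library.Function_Algebras" "HOL-Combinatorics.Permutations"
begin

text \<open>
  The ground field is a type of class \<^class>\<open>real_normed_field\<close>. Its norm is multiplicative, so by
  the Gelfand-Mazur theorem the models of this class are exactly the real and the complex
  numbers. A vector space over it is a type together with a scalar multiplication \<open>s\<close> such
  that \<^term>\<open>vector_space s\<close> holds; its dimension is arbitrary. The ground field itself,
  as a vector space, has the scalar multiplication \<^term>\<open>(*)\<close>.
\<close>

definition fscale :: "('f \<Rightarrow> 'w \<Rightarrow> 'w) \<Rightarrow> 'f \<Rightarrow> ('x \<Rightarrow> 'w) \<Rightarrow> 'x \<Rightarrow> 'w" where
  "fscale sW c g = (\<lambda>x. sW c (g x))"

definition lin_ops ::
  "('f \<Rightarrow> 'a \<Rightarrow> 'a) \<Rightarrow> ('f \<Rightarrow> 'b \<Rightarrow> 'b) \<Rightarrow> 'a::plus set \<Rightarrow> 'b::plus set \<Rightarrow> ('a \<Rightarrow> 'b) set" where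
  "lin_ops sU sW U W = {T. T ` U \<subseteq> W \<and>
     (\<forall>x\<in>U. \<forall>y\<in>U. T (x + y) = T x + T y) \<and> (\<forall>c. \<forall>x\<in>U. T (sU c x) = sW c (T x))}"

definition dual :: "('f::field \<Rightarrow> 'v::ab_group_add \<Rightarrow> 'v) \<Rightarrow> ('v \<Rightarrow> 'f) set" where
  "dual s = {\<omega>. Vector_Spaces.linear s (*) \<omega>}"


subsection \<open>Symmetric tensor powers\<close>

text \<open>
  A function on lists satisfying \<open>multilinear\<close> is a family consisting of one \<open>n\<close>-linear form
  (its restriction to the lists of length \<open>n\<close>) for every \<open>n\<close>. The tensor
  \<open>v\<^sub>1 \<otimes> \<dots> \<otimes> v\<^sub>n\<close> is realised as the evaluation of \<open>n\<close>-linear forms at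
  \<open>[v\<^sub>1, \<dots>, v\<^sub>n]\<close>: this embeds the algebraic tensor power into the dual of the space of
  \<open>n\<close>-linear forms. All degrees live in one type, and different degrees are linearly independent.
  The empty tensor \<^term>\<open>tensor s []\<close> is the unit, and \<open>V\<^sup>\<odot>\<^sup>0\<close>, the line it spans, is
  identified with the ground field.
\<close>

type_synonym ('f, 'v) tensor = "('v list \<Rightarrow> 'f) \<Rightarrow> 'f"

definition multilinear :: "('f::field \<Rightarrow> 'v::ab_group_add \<Rightarrow> 'v) \<Rightarrow> ('v list \<Rightarrow> 'f) \<Rightarrow> bool" where
  "multilinear s \<phi> \<longleftrightarrow>
     (\<forall>xs ys u v. \<phi> (xs @ (u + v) # ys) = \<phi> (xs @ u # ys) + \<phi> (xs @ v # ys)) \<and>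
     (\<forall>xs ys c v. \<phi> (xs @ s c v # ys) = c * \<phi> (xs @ v # ys))"

definition tensor :: "('f::field \<Rightarrow> 'v::ab_group_add \<Rightarrow> 'v) \<Rightarrow> 'v list \<Rightarrow> ('f, 'v) tensor" where
  "tensor s vs = (\<lambda>\<phi>. if multilinear s \<phi> then \<phi> vs else 0)"

abbreviation tscale :: "'f::field \<Rightarrow> ('f, 'v) tensor \<Rightarrow> ('f, 'v) tensor" where
  "tscale \<equiv> fscale (*)"

text \<open>\<open>v\<^sub>1 \<odot> \<dots> \<odot> v\<^sub>n\<close>\<close>

definition sym_tensor :: "('f::field_char_0 \<Rightarrow> 'v::ab_group_add \<Rightarrow> 'v) \<Rightarrow> 'v list \<Rightarrow> ('f, 'v) tensor" where
  "sym_tensor s vs = tscale (1 / fact (length vs))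
     (\<Sum>\<pi> | \<pi> permutes {..<length vs}. tensor s (permute_list \<pi> vs))"

text \<open>\<open>V\<^sup>\<odot>\<^sup>n\<close>\<close>

definition sympow :: "('f::field_char_0 \<Rightarrow> 'v::ab_group_add \<Rightarrow> 'v) \<Rightarrow> nat \<Rightarrow> ('f, 'v) tensor set" where
  "sympow s n = module.span tscale {sym_tensor s vs | vs. length vs = n}"

text \<open>\<open>v\<^sup>\<otimes>\<^sup>n\<close>\<close>

definition tpow :: "('f::field \<Rightarrow> 'v::ab_group_add \<Rightarrow> 'v) \<Rightarrow> 'v \<Rightarrow> nat \<Rightarrow> ('f, 'v) tensor" where
  "tpow s v n = tensor s (replicate n v)"

text \<open>
  The bilinear product of symmetric tensors. It is characterised by the lemma
  \<open>sym_mult_sym_tensor\<close> below.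
\<close>

definition sym_mult ::
  "('f::field_char_0 \<Rightarrow> 'v::ab_group_add \<Rightarrow> 'v) \<Rightarrow> ('f, 'v) tensor \<Rightarrow> ('f, 'v) tensor \<Rightarrow> ('f, 'v) tensor" where
  "sym_mult s t u = (\<lambda>\<phi>. t (\<lambda>xs. u (\<lambda>ys. sym_tensor s (xs @ ys) \<phi>)))"

lemma sum_fun_apply: "(\<Sum>a\<in>A. g a) x = (\<Sum>a\<in>A. g a x)"
  for g :: "'a \<Rightarrow> 'b \<Rightarrow> 'c::ab_group_add"
  by (induction A rule: infinite_finite_induct) auto

lemma sym_tensor_apply:
  "sym_tensor s vs \<phi> = (if multilinear s \<phi>
     then 1 / fact (length vs) * (\<Sum>\<pi> | \<pi> permutes {..<length vs}. \<phi> (permute_list \<pi> vs)) else 0)"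
  by (simp add: sym_tensor_def fscale_def sum_fun_apply tensor_def)

lemma sym_tensor_cong_mset:
  assumes "mset xs = mset ys"
  shows "sym_tensor s xs = sym_tensor s ys"
proof -
  obtain \<rho> where \<rho>: "\<rho> permutes {..<length ys}" "permute_list \<rho> ys = xs"
    using mset_eq_permutation[OF assms] by blast
  have "(\<Sum>\<pi> | \<pi> permutes {..<length ys}. tensor s (permute_list \<pi> ys)) =
        (\<Sum>\<pi> | \<pi> permutes {..<length ys}. tensor s (permute_list (\<rho> \<circ> \<pi>) ys))"
    by (rule setum_permutations_compose_left[OF \<rho>(1)])
  also have "\<dots> = (\<Sum>\<pi> | \<pi> permutes {..<length ys}. tensor s (permute_list \<pi> xs))"
    by (intro sum.cong) (auto simp: permute_list_compose \<rho>)
  finally show ?thesis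
    using \<rho>(2) by (auto simp: sym_tensor_def)
qed

lemma permute_list_middle:
  assumes "\<pi> permutes {..<length (as @ w # bs)}"
  shows "\<exists>cs ds. \<forall>w. permute_list \<pi> (as @ w # bs) = cs @ w # ds"
proof -
  define j where "j = inv \<pi> (length as)"
  define zs where "zs = permute_list \<pi> (as @ w # bs)"
  have j: "j < length zs"
    using permutes_in_image[OF permutes_inv[OF assms], of "length as"] by (simp add: j_def zs_def)
  have "permute_list \<pi> (as @ u # bs) = zs[j := u]" for u
  proof (rule nth_equalityI)
    fix i assume "i < length (permute_list \<pi> (as @ u # bs))"
    moreover have "\<pi> i = length as \<longleftrightarrow> i = j"
      using permutes_inverses[OF assms] unfolding j_def by metis
    ultimately show "permute_list \<pi> (as @ u # bs) ! i = zs[j := u] ! i"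
      using assms by (auto simp: zs_def permute_list_nth nth_list_update nth_append nth_Cons')
  qed (simp add: zs_def)
  then show ?thesis
    using upd_conv_take_nth_drop[OF j]
    by (intro exI[of _ "take j zs"] exI[of _ "drop (Suc j) zs"]) simp
qed

lemma multilinear_sym_tensor:
  assumes "multilinear s \<phi>"
  shows "multilinear s (\<lambda>vs. sym_tensor s vs \<phi>)"
proof -
  have add: "\<phi> (permute_list \<pi> (as @ (u + v) # bs)) =
      \<phi> (permute_list \<pi> (as @ u # bs)) + \<phi> (permute_list \<pi> (as @ v # bs))"
    and mult: "\<phi> (permute_list \<pi> (as @ s c v # bs)) = c * \<phi> (permute_list \<pi> (as @ v # bs))"
    if \<pi>: "\<pi> permutes {..<Suc (length as + length bs)}" for \<pi> as bs u v c
  proof -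
    obtain cs ds where "\<forall>w. permute_list \<pi> (as @ w # bs) = cs @ w # ds"
      using permute_list_middle[of \<pi> as v bs] \<pi> by auto
    then show "\<phi> (permute_list \<pi> (as @ (u + v) # bs)) =
      \<phi> (permute_list \<pi> (as @ u # bs)) + \<phi> (permute_list \<pi> (as @ v # bs))"
      and "\<phi> (permute_list \<pi> (as @ s c v # bs)) = c * \<phi> (permute_list \<pi> (as @ v # bs))"
      using assms by (simp_all add: multilinear_def)
  qed
  show ?thesis
    unfolding multilinear_def
    using assms by (simp add: sym_tensor_apply add mult sum.distrib sum_distrib_left distrib_left mult.left_commute)
qed

lemma sym_mult_sym_tensor:
  "sym_mult s (sym_tensor s xs) (sym_tensor s ys) = sym_tensor s (xs @ ys)"
proof
  fix \<phi>
  have zero: "multilinear s (\<lambda>_. 0)"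
    by (simp add: multilinear_def)
  have app: "sym_tensor s vs \<psi> = c"
    if "multilinear s \<psi>" "\<And>ws. mset ws = mset vs \<Longrightarrow> \<psi> ws = c" for vs \<psi> c
  proof -
    have "(\<Sum>\<pi> | \<pi> permutes {..<length vs}. \<psi> (permute_list \<pi> vs)) =
          (\<Sum>\<pi> | \<pi> permutes {..<length vs}. c)"
      using that(2) by (intro sum.cong) auto
    also have "\<dots> = fact (length vs) * c"
      by (simp add: card_permutations)
    finally show ?thesis
      using that(1) by (simp add: sym_tensor_apply)
  qed
  show "sym_mult s (sym_tensor s xs) (sym_tensor s ys) \<phi> = sym_tensor s (xs @ ys) \<phi>"
  proof (cases "multilinear s \<phi>")
    case False
    then show ?thesis
      using app[OF zero, of _ 0] by (simp add: sym_mult_def sym_tensor_apply[of _ _ \<phi>])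
  next
    case True
    note ml = multilinear_sym_tensor[OF True]
    have left: "multilinear s (\<lambda>zs. sym_tensor s (ws @ zs) \<phi>)" for ws
      using ml unfolding multilinear_def by (metis append.assoc)
    have right: "multilinear s (\<lambda>ws. sym_tensor s (ws @ zs) \<phi>)" for zs
      using ml unfolding multilinear_def by simp
    have "sym_tensor s ys (\<lambda>zs. sym_tensor s (ws @ zs) \<phi>) = sym_tensor s (ws @ ys) \<phi>" for ws
      by (rule app[OF left]) (metis mset_append sym_tensor_cong_mset)
    moreover have "sym_tensor s xs (\<lambda>ws. sym_tensor s (ws @ ys) \<phi>) = sym_tensor s (xs @ ys) \<phi>"
      by (rule app[OF right]) (metis mset_append sym_tensor_cong_mset)
    ultimately show ?thesis
      by (simp add: sym_mult_def)
  qed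
qed

lemma sym_tensor_replicate: "sym_tensor s (replicate n v) = tpow s v n"
  for s :: "'f::field_char_0 \<Rightarrow> 'v::ab_group_add \<Rightarrow> 'v"
proof
  fix \<phi> :: "'v list \<Rightarrow> 'f"
  have "permute_list \<pi> (replicate n v) = replicate n v" if "\<pi> permutes {..<n}" for \<pi>
    using that by (intro replicate_eqI) (auto simp: set_permute_list)
  then have "(\<Sum>\<pi> | \<pi> permutes {..<n}. \<phi> (permute_list \<pi> (replicate n v))) =
      (\<Sum>\<pi> | \<pi> permutes {..<n}. \<phi> (replicate n v))"
    by (intro sum.cong) simp_all
  also have "\<dots> = fact n * \<phi> (replicate n v)"
    by (simp add: card_permutations)
  finally show "sym_tensor s (replicate n v) \<phi> = tpow s v n \<phi>"
    by (simp add: sym_tensor_apply tpow_def tensor_def)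
qed

text \<open>The pairing \<open>\<langle>\<omega>\<^sup>\<otimes>\<^sup>n, t\<rangle>\<close>; the degree \<open>n\<close> is that of \<open>t\<close>.\<close>

definition dual_pow :: "('v \<Rightarrow> 'f::field) \<Rightarrow> ('f, 'v) tensor \<Rightarrow> 'f" where
  "dual_pow \<omega> t = t (\<lambda>vs. \<Prod>v\<leftarrow>vs. \<omega> v)"

text \<open>
  The linear operator on \<open>V\<^sup>\<odot>\<^sup>n\<close> with prescribed values \<open>g v\<close> at the vectors \<open>v\<^sup>\<otimes>\<^sup>n\<close>. These
  vectors span \<open>V\<^sup>\<odot>\<^sup>n\<close>, so there is at most one; outside \<open>V\<^sup>\<odot>\<^sup>n\<close> its values are
  irrelevant and unspecified.
\<close>

definition sym_op ::
  "('f::field_char_0 \<Rightarrow> 'v::ab_group_add \<Rightarrow> 'v) \<Rightarrow> ('f \<Rightarrow> 'w \<Rightarrow> 'w::ab_group_add) \<Rightarrow> nat \<Rightarrow> ('v \<Rightarrow> 'w)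
    \<Rightarrow> ('f, 'v) tensor \<Rightarrow> 'w" where
  "sym_op s sW n g = (SOME T. T \<in> lin_ops tscale sW (sympow s n) UNIV \<and> (\<forall>v. T (tpow s v n) = g v))"


subsection \<open>Formal tensor power series\<close>

text \<open>
  A series \<open>A\<close> is its sequence of coefficient operators \<open>A n\<close> on \<open>V\<^sup>\<odot>\<^sup>n\<close>. The zeroth
  coefficient, an element of \<open>W\<close>, is \<^term>\<open>A 0 (tensor s [])\<close>. Values of \<open>A n\<close> outside
  \<open>V\<^sup>\<odot>\<^sup>n\<close> are irrelevant, hence equality of series is \<open>fts_eq\<close>.
\<close>

type_synonym ('f, 'v, 'w) fts = "nat \<Rightarrow> ('f, 'v) tensor \<Rightarrow> 'w"

definition fts ::
  "('f::field_char_0 \<Rightarrow> 'v::ab_group_add \<Rightarrow> 'v) \<Rightarrow> ('f \<Rightarrow> 'w \<Rightarrow> 'w::ab_group_add) \<Rightarrow> ('f, 'v, 'w) fts set" where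
  "fts s sW = {A. \<forall>n. A n \<in> lin_ops tscale sW (sympow s n) UNIV}"

definition fts_eq ::
  "('f::field_char_0 \<Rightarrow> 'v::ab_group_add \<Rightarrow> 'v) \<Rightarrow> ('f, 'v, 'w) fts \<Rightarrow> ('f, 'v, 'w) fts \<Rightarrow> bool" where
  "fts_eq s A A' \<longleftrightarrow> (\<forall>n. \<forall>f\<in>sympow s n. A n f = A' n f)"

definition fts_mult ::
  "('f::field_char_0 \<Rightarrow> 'v::ab_group_add \<Rightarrow> 'v) \<Rightarrow> ('f, 'v, 'f) fts \<Rightarrow> ('f, 'v, 'f) fts \<Rightarrow> ('f, 'v, 'f) fts" where
  "fts_mult s A C = (\<lambda>n f. \<Sum>k\<le>n.
     sym_op s (*) n (\<lambda>v. A k (tpow s v k) * C (n - k) (tpow s v (n - k))) f)"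

definition fts_one :: "('f::field_char_0 \<Rightarrow> 'v::ab_group_add \<Rightarrow> 'v) \<Rightarrow> ('f, 'v, 'f) fts" where
  "fts_one s = (\<lambda>n. if n = 0 then sym_op s (*) 0 (\<lambda>v. 1) else 0)"

text \<open>
  \<open>\<Sum>k. C(v)\<^sup>k / k!\<close> for \<open>C(0) = 0\<close>: the powers with \<open>k > n\<close> do not contribute to the \<open>n\<close>th
  coefficient.
\<close>

definition fts_exp ::
  "('f::field_char_0 \<Rightarrow> 'v::ab_group_add \<Rightarrow> 'v) \<Rightarrow> ('f, 'v, 'f) fts \<Rightarrow> ('f, 'v, 'f) fts" where
  "fts_exp s C = (\<lambda>n f. \<Sum>k\<le>n. (1 / fact k) * (fts_mult s C ^^ k) (fts_one s) n f)"

text \<open>\<open>B\<^bsub>i\<^sub>1\<^esub> \<odot> \<dots> \<odot> B\<^bsub>i\<^sub>m\<^esub>\<close>, an operator from \<open>V\<^sup>\<odot>\<^sup>n\<close> to \<open>V\<^sup>\<odot>\<^sup>m\<close> with \<open>n = i\<^sub>1 + \<dots> + i\<^sub>m\<close>\<close>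

definition sym_op_prod ::
  "('f::field_char_0 \<Rightarrow> 'v::ab_group_add \<Rightarrow> 'v) \<Rightarrow> ('f, 'v, 'v) fts \<Rightarrow> nat list
    \<Rightarrow> ('f, 'v) tensor \<Rightarrow> ('f, 'v) tensor" where
  "sym_op_prod s B is =
     sym_op s tscale (sum_list is) (\<lambda>v. sym_tensor s (map (\<lambda>i. B i (tpow s v i)) is))"

definition fts_comp ::
  "('f::field_char_0 \<Rightarrow> 'v::ab_group_add \<Rightarrow> 'v) \<Rightarrow> ('f, 'v, 'w::ab_group_add) fts \<Rightarrow> ('f, 'v, 'v) fts
    \<Rightarrow> ('f, 'v, 'w) fts" where
  "fts_comp s A B = (\<lambda>n f. if n = 0 then A 0 f else
     \<Sum>m=1..n. A m (\<Sum>is | length is = m \<and> (\<forall>i\<in>set is. 1 \<le> i) \<and> sum_list is = n. sym_op_prod s B is f))"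

text \<open>The series \<open>v\<close>, the identity under composition\<close>

definition fts_id :: "('f::field_char_0 \<Rightarrow> 'v::ab_group_add \<Rightarrow> 'v) \<Rightarrow> ('f, 'v, 'v) fts" where
  "fts_id s = (\<lambda>n. if n = 1 then sym_op s s 1 (\<lambda>v. v) else 0)"

text \<open>\<open>\<F>\<^sub>1(V)\<close>\<close>

definition fts1 :: "('f::field_char_0 \<Rightarrow> 'v::ab_group_add \<Rightarrow> 'v) \<Rightarrow> ('f, 'v, 'v) fts set" where
  "fts1 s = {B \<in> fts s s. B 0 (tensor s []) = 0 \<and> bij_betw (B 1) (sympow s 1) UNIV}"

definition fts_inverse ::
  "('f::field_char_0 \<Rightarrow> 'v::ab_group_add \<Rightarrow> 'v) \<Rightarrow> ('f, 'v, 'v) fts \<Rightarrow> ('f, 'v, 'v) fts \<Rightarrow> bool" where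
  "fts_inverse s B L \<longleftrightarrow> L \<in> fts1 s \<and>
     fts_eq s (fts_comp s B L) (fts_id s) \<and> fts_eq s (fts_comp s L B) (fts_id s)"

text \<open>\<open>A'(v; \<zeta>)\<close>; its coefficient of degree \<open>n\<close> comes from the coefficient of \<open>A\<close> of degree \<open>n + 1\<close>.
  The vector \<open>\<zeta>\<close> is identified with \<^term>\<open>tensor s [\<zeta>]\<close>.\<close>

definition fts_deriv ::
  "('f::field_char_0 \<Rightarrow> 'v::ab_group_add \<Rightarrow> 'v) \<Rightarrow> ('f \<Rightarrow> 'w \<Rightarrow> 'w) \<Rightarrow> ('f, 'v, 'w::ab_group_add) fts \<Rightarrow> 'v
    \<Rightarrow> ('f, 'v, 'w) fts" where
  "fts_deriv s sW A \<zeta> = (\<lambda>n f. sW (of_nat (n + 1)) (A (n + 1) (sym_mult s f (tensor s [\<zeta>]))))"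


subsection \<open>Polynomials on the dual space\<close>

text \<open>
  Functions on \<open>V\<^sup>*\<close> are extended by zero, so that polynomials which agree on \<open>V\<^sup>*\<close> are equal.
\<close>

definition on_dual ::
  "('f::field \<Rightarrow> 'v::ab_group_add \<Rightarrow> 'v) \<Rightarrow> (('v \<Rightarrow> 'f) \<Rightarrow> 'w::zero) \<Rightarrow> ('v \<Rightarrow> 'f) \<Rightarrow> 'w" where
  "on_dual s g = (\<lambda>\<omega>. if \<omega> \<in> dual s then g \<omega> else 0)"

definition polys :: "('f::field_char_0 \<Rightarrow> 'v::ab_group_add \<Rightarrow> 'v) \<Rightarrow> (('v \<Rightarrow> 'f) \<Rightarrow> 'f) set" where
  "polys s = {on_dual s (\<lambda>\<omega>. \<Sum>k\<le>n. dual_pow \<omega> (f k)) | n f. \<forall>k\<le>n. f k \<in> sympow s k}"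

text \<open>\<open>\<P>(V\<^sup>*, W)\<close>\<close>

definition polys_into ::
  "('f::field_char_0 \<Rightarrow> 'v::ab_group_add \<Rightarrow> 'v) \<Rightarrow> ('f \<Rightarrow> 'w \<Rightarrow> 'w::ab_group_add) \<Rightarrow> 'w set
    \<Rightarrow> (('v \<Rightarrow> 'f) \<Rightarrow> 'w) set" where
  "polys_into s sW W = module.span (fscale sW) {\<lambda>\<omega>. sW (p \<omega>) w | p w. p \<in> polys s \<and> w \<in> W}"

text \<open>\<open>D\<^sup>k\<close>. The product below is \<open>n (n - 1) \<dots> (n - k + 1)\<close>, which is zero if \<open>k > n\<close>.\<close>

definition Dop ::
  "('f::field_char_0 \<Rightarrow> 'v::ab_group_add \<Rightarrow> 'v) \<Rightarrow> nat \<Rightarrow> (('v \<Rightarrow> 'f) \<Rightarrow> 'f) \<Rightarrow> ('v \<Rightarrow> 'f) \<Rightarrow> ('f, 'v) tensor" where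
  "Dop s k = (SOME D. D \<in> lin_ops (fscale (*)) (fscale tscale) (polys s) (polys_into s tscale (sympow s k)) \<and>
     (\<forall>n v. \<forall>\<omega>\<in>dual s. D (on_dual s (\<lambda>\<omega>'. dual_pow \<omega>' (tpow s v n))) \<omega> =
        tscale ((\<Prod>i<k. of_nat n - of_nat i) * \<omega> v ^ (n - k)) (tpow s v k)))"

text \<open>\<open>(G(D)p)(\<omega>)\<close>\<close>

definition fts_op ::
  "('f::field_char_0 \<Rightarrow> 'v::ab_group_add \<Rightarrow> 'v) \<Rightarrow> ('f \<Rightarrow> 'w \<Rightarrow> 'w::ab_group_add) \<Rightarrow> ('f, 'v, 'w) fts
    \<Rightarrow> (('v \<Rightarrow> 'f) \<Rightarrow> 'f) \<Rightarrow> ('v \<Rightarrow> 'f) \<Rightarrow> 'w" where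
  "fts_op s sW G p \<omega> = sW (p \<omega>) (G 0 (tensor s [])) +
     (\<Sum>k | 1 \<le> k \<and> Dop s k p \<omega> \<noteq> 0. G k (Dop s k p \<omega>))"


subsection \<open>Sheffer sequences and raising operators\<close>

definition polynomial_sequence ::
  "('f::field_char_0 \<Rightarrow> 'v::ab_group_add \<Rightarrow> 'v) \<Rightarrow> (nat \<Rightarrow> ('v \<Rightarrow> 'f) \<Rightarrow> ('f, 'v) tensor \<Rightarrow> 'f) \<Rightarrow> bool" where
  "polynomial_sequence s S \<longleftrightarrow>
     (\<forall>n. \<forall>\<omega>\<in>dual s. S n \<omega> \<in> lin_ops tscale (*) (sympow s n) UNIV) \<and>
     (\<exists>T. (\<forall>n. \<forall>k\<le>n. T k n \<in> lin_ops tscale tscale (sympow s n) (sympow s k)) \<and>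
          (\<forall>n. bij_betw (T n n) (sympow s n) (sympow s n)) \<and>
          (\<forall>n. \<forall>\<omega>\<in>dual s. \<forall>f\<in>sympow s n. S n \<omega> f = (\<Sum>k\<le>n. dual_pow \<omega> (T k n f))))"

text \<open>\<open>\<Sum>n. \<langle>S\<^sub>n(\<omega>), v\<^sup>\<otimes>\<^sup>n\<rangle> / n!\<close>\<close>

definition gen_fun ::
  "(nat \<Rightarrow> ('v \<Rightarrow> 'f::field_char_0) \<Rightarrow> ('f, 'v) tensor \<Rightarrow> 'f) \<Rightarrow> ('v \<Rightarrow> 'f) \<Rightarrow> ('f, 'v, 'f) fts" where
  "gen_fun S \<omega> = (\<lambda>n f. (1 / fact n) * S n \<omega> f)"

definition sheffer_sequence ::
  "('f::field_char_0 \<Rightarrow> 'v::ab_group_add \<Rightarrow> 'v) \<Rightarrow> (nat \<Rightarrow> ('v \<Rightarrow> 'f) \<Rightarrow> ('f, 'v) tensor \<Rightarrow> 'f) \<Rightarrow> bool" where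
  "sheffer_sequence s S \<longleftrightarrow> polynomial_sequence s S \<and>
     (\<exists>B\<in>fts1 s. \<exists>A\<in>fts s (*). A 0 (tensor s []) \<noteq> 0 \<and>
        (\<forall>\<omega>\<in>dual s. fts_eq s (gen_fun S \<omega>) (fts_mult s (fts_exp s (\<lambda>n f. \<omega> (B n f))) A)))"

definition raising_operator ::
  "('f::field_char_0 \<Rightarrow> 'v::ab_group_add \<Rightarrow> 'v) \<Rightarrow> (nat \<Rightarrow> ('v \<Rightarrow> 'f) \<Rightarrow> ('f, 'v) tensor \<Rightarrow> 'f) \<Rightarrow> 'v
    \<Rightarrow> ((('v \<Rightarrow> 'f) \<Rightarrow> 'f) \<Rightarrow> ('v \<Rightarrow> 'f) \<Rightarrow> 'f) \<Rightarrow> bool" where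
  "raising_operator s S \<zeta> R \<longleftrightarrow>
     R \<in> lin_ops (fscale (*)) (fscale (*)) (polys s) (polys s) \<and>
     (\<forall>n. \<forall>f\<in>sympow s n. \<forall>\<omega>\<in>dual s.
        R (on_dual s (\<lambda>\<omega>'. S n \<omega>' f)) \<omega> = S (n + 1) \<omega> (sym_mult s f (tensor s [\<zeta>])))"

end

theory Submission
  imports Defs "HOL-Computational_Algebra.Formal_Power_Series"
begin

text \<open>
  Both sides of the identity are linear in \<open>p\<close>, and by polarization the powers
  \<open>\<omega> \<mapsto> \<langle>\<omega>, u\<rangle>\<^sup>j\<close> span the polynomials (\<open>polys_eq_span\<close>). On them the right-hand side can be read
  off from the definition of \<open>D\<close>: collected in the exponential series, it says that
  \<open>G(D) e\<^bsup>\<langle>\<omega>, u\<rangle>\<^esup> = e\<^bsup>\<langle>\<omega>, u\<rangle>\<^esup> G(u)\<close> for every formal series \<open>G\<close>. So the theorem amounts to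
  \<open>R(\<zeta>) e\<^bsup>\<langle>\<omega>, u\<rangle>\<^esup> = e\<^bsup>\<langle>\<omega>, u\<rangle>\<^esup> (\<langle>\<omega>, \<Phi>\<^sub>\<zeta>(u)\<rangle> + \<Gamma>\<^sub>\<zeta>(u))\<close>, an identity of formal series in \<open>u\<close>
  (\<open>raising_operator_on_powers\<close>).

  Write \<open>F\<^sub>\<omega>(v) = exp[\<langle>\<omega>, B(v)\<rangle> + \<alpha>(v)]\<close> for the generating function. Raising \<open>\<langle>S\<^sub>n(\<omega>), f\<rangle>\<close> to
  \<open>\<langle>S\<^sub>n\<^sub>+\<^sub>1(\<omega>), f \<odot> \<zeta>\<rangle>\<close> amounts, on generating functions, to differentiating in the direction \<open>\<zeta>\<close>,
  and the chain rule for the exponential (\<open>fts_exp_deriv\<close>) gives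
  \<open>F\<^sub>\<omega>'(v; \<zeta>) = F\<^sub>\<omega>(v) (\<langle>\<omega>, B'(v; \<zeta>)\<rangle> + \<alpha>'(v; \<zeta>))\<close>. The substitution \<open>v = L(u)\<close> turns \<open>F\<^sub>\<omega>(v)\<close> into
  \<open>e\<^bsup>\<langle>\<omega>, u\<rangle>\<^esup> E(u)\<close> with \<open>E(u) = e\<^bsup>\<alpha>(L(u))\<^esup>\<close>, and the last factor into \<open>\<langle>\<omega>, \<Phi>\<^sub>\<zeta>(u)\<rangle> + \<Gamma>\<^sub>\<zeta>(u)\<close>. Since \<open>E(u)\<close> is
  invertible and does not depend on \<open>\<omega>\<close>, it can be taken out of \<open>R(\<zeta>)\<close> and cancelled.

  To make the substitution precise, a formal tensor power series is evaluated along the formal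
  curve \<open>l(t) = \<Sum>\<^sub>i t\<^sup>i l\<^sub>i\<close> with \<open>l\<^sub>i = L\<^sub>i u\<^bsup>\<otimes>i\<^esup>\<close>, that is \<open>l(t) = L(t u)\<close>; the result is an ordinary
  power series in \<open>t\<close>. This evaluation respects products and exponentials (\<open>subst_fps_mult\<close>,
  \<open>subst_fps_exp\<close>), and it computes the composition with \<open>L\<close> (\<open>fts_comp_tpow\<close>).

  The definitions select the operators \<open>D\<^sup>k\<close> and the operators with prescribed values at \<open>v\<^bsup>\<otimes>n\<^esup>\<close>
  by a choice, so their existence has to be shown. For the latter an operator is built from a
  multilinear form (\<open>product_form\<close>, \<open>blocks\<close>). For \<open>D\<^sup>k\<close> the point is that a polynomial determines its
  homogeneous components (\<open>polynomial_components_unique\<close>).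
\<close>

unbundle fps_syntax

section \<open>Linear operators on subspaces\<close>

lemma vector_space_field: "vector_space ((*) :: 'f::field \<Rightarrow> 'f \<Rightarrow> 'f)"
  by unfold_locales (simp_all add: algebra_simps)

lemma subspace_zero_field: "module.subspace (*) {0 :: 'f::field}"
proof -
  interpret vector_space "(*) :: 'f \<Rightarrow> 'f \<Rightarrow> 'f" by (rule vector_space_field)
  show ?thesis by (rule subspace_single_0)
qed

lemma vector_space_fscale: "vector_space sW \<Longrightarrow> vector_space (fscale sW)"
  unfolding vector_space_def fscale_def by (simp add: fun_eq_iff)

interpretation field_fun: vector_space "fscale ((*) :: 'f::field \<Rightarrow> 'f \<Rightarrow> 'f)"
  by (intro vector_space_fscale vector_space_field)

lemma lin_opsI:
  assumes "\<And>x. x \<in> U \<Longrightarrow> T x \<in> W"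
    and "\<And>x y. x \<in> U \<Longrightarrow> y \<in> U \<Longrightarrow> T (x + y) = T x + T y"
    and "\<And>c x. x \<in> U \<Longrightarrow> T (sU c x) = sW c (T x)"
  shows "T \<in> lin_ops sU sW U W"
  using assms by (auto simp: lin_ops_def)

lemma
  assumes "T \<in> lin_ops sU sW U W"
  shows lin_ops_mem: "x \<in> U \<Longrightarrow> T x \<in> W"
    and lin_ops_add: "x \<in> U \<Longrightarrow> y \<in> U \<Longrightarrow> T (x + y) = T x + T y"
    and lin_ops_scale: "x \<in> U \<Longrightarrow> T (sU c x) = sW c (T x)"
  using assms by (auto simp: lin_ops_def)

lemma lin_ops_zero:
  assumes "T \<in> lin_ops sU sW U W" "vector_space sU" "module.subspace sU U"
  shows "T 0 = (0 :: 'b::ab_group_add)"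
proof -
  interpret vector_space sU by fact
  have "T (0 + 0) = T 0 + T 0"
    using lin_ops_add[OF assms(1)] subspace_0[OF assms(3)] by blast
  then show ?thesis by simp
qed

lemma lin_ops_sum:
  assumes T: "T \<in> lin_ops sU sW U W" "vector_space sU" "module.subspace sU U"
    and "\<And>i. i \<in> I \<Longrightarrow> x i \<in> U"
  shows "T (\<Sum>i\<in>I. x i) = (\<Sum>i\<in>I. T (x i) :: 'b::ab_group_add)"
proof -
  interpret vector_space sU by fact
  show ?thesis
    using assms(4)
    by (induction I rule: infinite_finite_induct)
      (simp_all add: lin_ops_zero[OF T] lin_ops_add[OF T(1)] subspace_sum[OF T(3)])
qed

lemma lin_ops_span_cong:
  assumes T: "T \<in> lin_ops sU sW (module.span sU X) UNIV" "T' \<in> lin_ops sU sW (module.span sU X) UNIV"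
    and sU: "vector_space sU"
    and "\<And>x. x \<in> X \<Longrightarrow> T x = T' x" and f: "f \<in> module.span sU X"
  shows "T f = (T' f :: 'b::ab_group_add)"
proof -
  interpret vector_space sU by fact
  have "f \<in> span X \<and> T f = T' f"
    using f
  proof (induction rule: span_induct_alt)
    case base
    then show ?case using lin_ops_zero[OF T(1) sU] lin_ops_zero[OF T(2) sU] by (simp add: span_zero)
  next
    case (step c x y)
    then show ?case
      using assms(4)[of x] lin_ops_add[OF T(1)] lin_ops_add[OF T(2)] lin_ops_scale[OF T(1)] lin_ops_scale[OF T(2)]
      by (simp add: span_add span_scale span_base)
  qed
  then show ?thesis by simp
qed

lemma lin_ops_span_into:
  assumes T: "T \<in> lin_ops sU sW (module.span sU X) UNIV"
    and sU: "vector_space sU" and sW: "vector_space sW" and W: "module.subspace sW W"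
    and "\<And>x. x \<in> X \<Longrightarrow> T x \<in> W" and f: "f \<in> module.span sU X"
  shows "T f \<in> (W :: 'b::ab_group_add set)"
proof -
  interpret vector_space sU by fact
  interpret W: vector_space sW by fact
  have "f \<in> span X \<and> T f \<in> W"
    using f
  proof (induction rule: span_induct_alt)
    case base
    then show ?case using lin_ops_zero[OF T(1) sU] W.subspace_0[OF W] by (simp add: span_zero)
  next
    case (step c x y)
    then show ?case
      using assms(5)[of x] lin_ops_add[OF T(1)] lin_ops_scale[OF T(1)] W.subspace_add[OF W] W.subspace_scale[OF W]
      by (simp add: span_add span_scale span_base)
  qed
  then show ?thesis by simp
qed

section \<open>Polarization\<close>

text \<open>
  If \<open>p(t) = \<Sum>\<^sub>j t\<^sup>j x\<^sub>j\<close> has degree at most \<open>n + 1\<close>, then \<open>p(2t) - 2\<^bsup>n+1\<^esup> p(t)\<close> has degree at most \<open>n\<close> and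
  the coefficients \<open>(2\<^sup>j - 2\<^bsup>n+1\<^esup>) x\<^sub>j\<close>, so one can induct on the degree.
\<close>

lemma (in vector_space) subspace_polynomial_coeffs:
  assumes char: "\<And>n. of_nat (Suc n) \<noteq> (0::'a)"
    and U: "subspace U" and "\<And>t. (\<Sum>j\<le>n. (t ^ j) *s x j) \<in> U"
  shows "\<forall>j\<le>n. x j \<in> U"
  using assms(3)
proof (induction n arbitrary: x)
  case 0
  from 0[of 1] show ?case by simp
next
  case (Suc n)
  let ?y = "\<lambda>j. (2 ^ j - 2 ^ Suc n) *s x j"
  have two: "(2::'a) ^ j - 2 ^ Suc n \<noteq> 0" if "j \<le> n" for j
  proof
    assume "(2::'a) ^ j - 2 ^ Suc n = 0"
    moreover have le: "2 ^ j < (2::nat) ^ Suc n"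
      using that by (intro power_strict_increasing) auto
    ultimately have "of_nat (2 ^ Suc n - 2 ^ j) = (0::'a)"
      by (simp add: of_nat_diff)
    then show False
      using char[of "2 ^ Suc n - 2 ^ j - 1"] le by (metis Suc_diff_1 zero_less_diff)
  qed
  have "(\<Sum>j\<le>n. (t ^ j) *s ?y j) \<in> U" for t
  proof -
    have summand: "t ^ j *s ?y j = (2 * t) ^ j *s x j - 2 ^ Suc n *s (t ^ j *s x j)" for j
    proof -
      have "t ^ j *s ?y j = (t ^ j * (2 ^ j - 2 ^ Suc n)) *s x j"
        by (rule scale_scale)
      also have "t ^ j * (2 ^ j - 2 ^ Suc n) = (2 * t) ^ j - 2 ^ Suc n * t ^ j"
        by (simp only: right_diff_distrib power_mult_distrib mult.commute)
      finally show ?thesis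
        by (simp only: scale_left_diff_distrib scale_scale)
    qed
    have "(\<Sum>j\<le>n. (t ^ j) *s ?y j) = (\<Sum>j\<le>Suc n. (t ^ j) *s ?y j)"
      by simp
    also have "\<dots> = (\<Sum>j\<le>Suc n. ((2 * t) ^ j) *s x j) - 2 ^ Suc n *s (\<Sum>j\<le>Suc n. (t ^ j) *s x j)"
      unfolding scale_sum_right sum_subtractf[symmetric]
      by (intro sum.cong refl summand)
    finally show ?thesis
      by (rule ssubst) (intro subspace_diff[OF U] subspace_scale[OF U] Suc.prems)
  qed
  then have "?y j \<in> U" if "j \<le> n" for j
    using Suc.IH[of ?y] that by auto
  then have *: "x j \<in> U" if "j \<le> n" for j
    using subspace_scale[OF U, of "?y j" "1 / (2 ^ j - 2 ^ Suc n)"] two[OF that] that by simp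
  have "(\<Sum>j\<le>Suc n. (1 ^ j) *s x j) - (\<Sum>j\<le>n. x j) \<in> U"
    by (intro subspace_diff[OF U] subspace_sum[OF U] Suc.prems) (simp add: *)
  then have "x (Suc n) \<in> U" by simp
  then show ?case using * by (auto simp: le_Suc_eq)
qed

locale symmetric_multilinear = A: vector_space sA + W: vector_space sW
  for sA :: "'f::field_char_0 \<Rightarrow> 'a::ab_group_add \<Rightarrow> 'a" and sW :: "'f \<Rightarrow> 'w::ab_group_add \<Rightarrow> 'w" +
  fixes M :: "'a list \<Rightarrow> 'w"
  assumes M_mset: "mset xs = mset ys \<Longrightarrow> M xs = M ys"
    and M_add: "M ((u + v) # ys) = M (u # ys) + M (v # ys)"
    and M_scale: "M (sA c v # ys) = sW c (M (v # ys))"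
begin

text \<open>
  The coefficient of \<open>t\<close> serves twice: it allows one to replace a copy of \<open>u\<close> by \<open>w\<close> in the
  polarization, and it is the derivative of \<open>u \<mapsto> M(u, \<dots>, u)\<close> in the direction \<open>w\<close>.
\<close>

lemma expand:
  "\<exists>x. (\<forall>t. M (ws @ replicate k (u + sA t w)) = (\<Sum>j\<le>k. sW (t ^ j) (x j))) \<and> (\<forall>j>k. x j = 0) \<and>
       x 0 = M (ws @ replicate k u) \<and> x 1 = sW (of_nat k) (M (ws @ w # replicate (k - 1) u))"
proof (induction k arbitrary: ws)
  case 0
  show ?case by (intro exI[of _ "\<lambda>j. if j = 0 then M ws else 0"]) simp
next
  case (Suc k)
  obtain y where y: "\<And>t. M ((u # ws) @ replicate k (u + sA t w)) = (\<Sum>j\<le>k. sW (t ^ j) (y j))"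
      "\<And>j. j > k \<Longrightarrow> y j = 0"
      "y 0 = M ((u # ws) @ replicate k u)" "y 1 = sW (of_nat k) (M ((u # ws) @ w # replicate (k - 1) u))"
    using Suc[of "u # ws"] by auto
  obtain z where z: "\<And>t. M ((w # ws) @ replicate k (u + sA t w)) = (\<Sum>j\<le>k. sW (t ^ j) (z j))"
      "\<And>j. j > k \<Longrightarrow> z j = 0" "z 0 = M ((w # ws) @ replicate k u)"
    using Suc[of "w # ws"] by auto
  define x where "x = (\<lambda>j. y j + (if j = 0 then 0 else z (j - 1)))"
  have "M (ws @ replicate (Suc k) (u + sA t w)) = (\<Sum>j\<le>Suc k. sW (t ^ j) (x j))" for t
  proof -
    have "M (ws @ replicate (Suc k) (u + sA t w)) = M ((u + sA t w) # ws @ replicate k (u + sA t w))"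
      by (intro M_mset) simp
    also have "\<dots> = (\<Sum>j\<le>k. sW (t ^ j) (y j)) + sW t (\<Sum>j\<le>k. sW (t ^ j) (z j))"
      using y(1) z(1) by (simp add: M_add M_scale)
    also have "(\<Sum>j\<le>k. sW (t ^ j) (y j)) = (\<Sum>j\<le>Suc k. sW (t ^ j) (y j))"
      by (simp add: y(2))
    also have "sW t (\<Sum>j\<le>k. sW (t ^ j) (z j)) = (\<Sum>j\<le>Suc k. sW (t ^ j) (if j = 0 then 0 else z (j - 1)))"
      unfolding sum.atMost_Suc_shift by (simp add: W.scale_sum_right)
    finally show ?thesis
      by (simp add: x_def sum.distrib[symmetric] W.scale_right_distrib del: sum.atMost_Suc)
  qed
  moreover have "x 0 = M (ws @ replicate (Suc k) u)"
    using y(3) by (auto simp: x_def intro: M_mset)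
  moreover have "x 1 = sW (of_nat (Suc k)) (M (ws @ w # replicate k u))"
  proof -
    have "sW (of_nat k) (M ((u # ws) @ w # replicate (k - 1) u)) = sW (of_nat k) (M (ws @ w # replicate k u))"
    proof (cases k)
      case (Suc k')
      have "M ((u # ws) @ w # replicate (k - 1) u) = M (ws @ w # replicate k u)"
        by (intro M_mset) (simp add: Suc)
      then show ?thesis by simp
    qed simp
    moreover have "M ((w # ws) @ replicate k u) = M (ws @ w # replicate k u)"
      by (intro M_mset) simp
    ultimately show ?thesis
      using y(4) z(3) by (simp add: x_def W.scale_left_distrib)
  qed
  moreover have "\<forall>j>Suc k. x j = 0"
    using y(2) z(2) by (simp add: x_def)
  ultimately show ?case by (intro exI[of _ x]) simp
qed

text \<open>
  By induction on the number of arguments that differ from the repeated one: up to the factor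
  \<open>k + 1\<close>, the value \<open>M(ws, w, u, \<dots>, u)\<close> with \<open>k\<close> copies of \<open>u\<close> is the coefficient of \<open>t\<close> in
  \<open>M(ws, u + t w, \<dots>, u + t w)\<close>, where \<open>u + t w\<close> is repeated \<open>k + 1\<close> times.
\<close>

lemma polarization:
  assumes C: "\<And>u w t. u \<in> C \<Longrightarrow> w \<in> C \<Longrightarrow> u + sA t w \<in> C"
    and U: "W.subspace U" and diag: "\<And>u. u \<in> C \<Longrightarrow> M (replicate n u) \<in> U"
    and xs: "set xs \<subseteq> C" "length xs = n" and C0: "0 \<in> C"
  shows "M xs \<in> U"
proof -
  have "M (ws @ replicate k u) \<in> U" if "set ws \<subseteq> C" "u \<in> C" "length ws + k = n" for ws k u
    using that
  proof (induction ws arbitrary: k u)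
    case Nil
    then show ?case using diag by simp
  next
    case (Cons w ws)
    obtain x where x: "\<And>t. M (ws @ replicate (Suc k) (u + sA t w)) = (\<Sum>j\<le>Suc k. sW (t ^ j) (x j))"
      "x 1 = sW (of_nat (Suc k)) (M (ws @ w # replicate k u))"
      using expand[of ws "Suc k" u w] by auto
    have "\<forall>j\<le>Suc k. x j \<in> U"
    proof (rule W.subspace_polynomial_coeffs[OF _ U])
      fix t
      show "(\<Sum>j\<le>Suc k. sW (t ^ j) (x j)) \<in> U"
        unfolding x(1)[symmetric] using Cons.prems C by (intro Cons.IH) auto
    qed (rule of_nat_neq_0)
    then have "x 1 \<in> U" by simp
    from W.subspace_scale[OF U this, of "1 / of_nat (Suc k)"]
    have "sW (1 / of_nat (Suc k) * of_nat (Suc k)) (M (ws @ w # replicate k u)) \<in> U"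
      by (simp only: x(2) W.scale_scale)
    moreover have "1 / of_nat (Suc k) * of_nat (Suc k) = (1 :: 'f)"
      by (rule nonzero_eq_divide_eq[THEN iffD1, OF of_nat_neq_0 refl])
    ultimately have "M (ws @ w # replicate k u) \<in> U"
      by (simp only: W.scale_one)
    then show ?case
      using M_mset[of "(w # ws) @ replicate k u" "ws @ w # replicate k u"] by simp
  qed
  from this[of xs 0 0] xs C0 show ?thesis by simp
qed

end

section \<open>Compositions of a natural number\<close>

definition compositions :: "nat \<Rightarrow> nat \<Rightarrow> nat list set" where
  "compositions n j = {is. length is = n \<and> sum_list is = j}"

lemma finite_compositions: "finite (compositions n j)"
proof (rule finite_subset)
  show "compositions n j \<subseteq> {is. set is \<subseteq> {..j} \<and> length is = n}"
    by (auto simp: compositions_def intro: member_le_sum_list)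
qed (rule finite_lists_length_eq, simp)

text \<open>
  A composition of \<open>j\<close> with \<open>n + m\<close> parts is cut after its first \<open>n\<close> parts; \<open>i\<close> is the sum of these.
  This is the product rule for coefficients of powers of a curve.
\<close>

lemma sum_compositions_split:
  fixes g :: "nat list \<Rightarrow> nat list \<Rightarrow> 'a::comm_monoid_add"
  shows "(\<Sum>is\<in>compositions (n + m) j. g (take n is) (drop n is)) =
    (\<Sum>i\<le>j. \<Sum>is\<in>compositions n i. \<Sum>js\<in>compositions m (j - i). g is js)"
proof -
  have parts: "sum_list (take n is) + sum_list (drop n is) = sum_list is" for "is" :: "nat list"
    using sum_list_append[of "take n is" "drop n is"] by simp
  then have le: "sum_list (take n is) \<le> sum_list is" and diff: "sum_list (drop n is) = sum_list is - sum_list (take n is)"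
    for "is" :: "nat list"
    by (metis le_add1, metis add_diff_cancel_left')
  have "(\<Sum>i\<le>j. \<Sum>is\<in>compositions n i. \<Sum>js\<in>compositions m (j - i). g is js) =
      (\<Sum>(i, is, js)\<in>(SIGMA i:{..j}. compositions n i \<times> compositions m (j - i)). g is js)"
    by (simp add: sum.Sigma finite_compositions sum.cartesian_product)
  also have "\<dots> = (\<Sum>is\<in>compositions (n + m) j. g (take n is) (drop n is))"
    by (rule sum.reindex_bij_witness[of _ "\<lambda>is. (sum_list (take n is), take n is, drop n is)" "\<lambda>(i, is, js). is @ js"])
      (auto simp: compositions_def le diff)
  finally show ?thesis by simp
qed

section \<open>Symmetric tensors and operators on them\<close>

locale scalar_space = vector_space s
  for s :: "'f::field_char_0 \<Rightarrow> 'v::ab_group_add \<Rightarrow> 'v"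
begin

lemma multilinearI:
  assumes "\<And>xs ys u v. \<phi> (xs @ (u + v) # ys) = \<phi> (xs @ u # ys) + \<phi> (xs @ v # ys)"
    and "\<And>xs ys c v. \<phi> (xs @ s c v # ys) = c * \<phi> (xs @ v # ys)"
  shows "multilinear s \<phi>"
  using assms by (simp add: multilinear_def)

lemma
  assumes "multilinear s \<phi>"
  shows multilinear_add: "\<phi> (xs @ (u + v) # ys) = \<phi> (xs @ u # ys) + \<phi> (xs @ v # ys)"
    and multilinear_scale: "\<phi> (xs @ s c v # ys) = c * \<phi> (xs @ v # ys)"
  using assms by (simp_all add: multilinear_def)

lemma sym_tensor_add: "sym_tensor s (xs @ (u + v) # ys) = sym_tensor s (xs @ u # ys) + sym_tensor s (xs @ v # ys)"
proof
  fix \<phi>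
  show "sym_tensor s (xs @ (u + v) # ys) \<phi> = (sym_tensor s (xs @ u # ys) + sym_tensor s (xs @ v # ys)) \<phi>"
    using multilinear_add[OF multilinear_sym_tensor, of \<phi> xs u v ys]
    by (cases "multilinear s \<phi>") (simp_all, simp add: sym_tensor_apply)
qed

lemma sym_tensor_scale: "sym_tensor s (xs @ s c v # ys) = tscale c (sym_tensor s (xs @ v # ys))"
proof
  fix \<phi>
  show "sym_tensor s (xs @ s c v # ys) \<phi> = tscale c (sym_tensor s (xs @ v # ys)) \<phi>"
    using multilinear_scale[OF multilinear_sym_tensor, of \<phi> xs c v ys]
    by (cases "multilinear s \<phi>") (simp_all add: fscale_def, simp add: sym_tensor_apply)
qed

sublocale sym: symmetric_multilinear s tscale "sym_tensor s"
proof
  show "sym_tensor s ((u + v) # ys) = sym_tensor s (u # ys) + sym_tensor s (v # ys)" for u v ys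
    using sym_tensor_add[of "[]" u v ys] by (simp only: append_Nil)
  show "sym_tensor s (s c v # ys) = tscale c (sym_tensor s (v # ys))" for c v ys
    using sym_tensor_scale[of "[]" c v ys] by (simp only: append_Nil)
qed (rule sym_tensor_cong_mset)

lemma sym_tensor_mem: "length vs = n \<Longrightarrow> sym_tensor s vs \<in> sympow s n"
  unfolding sympow_def by (intro field_fun.span_base) auto

lemma subspace_sympow: "field_fun.subspace (sympow s n)"
  unfolding sympow_def by (rule field_fun.subspace_span)

lemma tpow_mem: "tpow s v n \<in> sympow s n"
  unfolding sym_tensor_replicate[symmetric] by (rule sym_tensor_mem) simp

lemma sympow_eq_span_tpow: "sympow s n = field_fun.span (range (\<lambda>v. tpow s v n))"
proof (rule antisym)
  show "sympow s n \<subseteq> field_fun.span (range (\<lambda>v. tpow s v n))"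
    unfolding sympow_def
  proof (rule field_fun.span_minimal)
    show "{sym_tensor s vs |vs. length vs = n} \<subseteq> field_fun.span (range (\<lambda>v. tpow s v n))"
      using sym.polarization[where C = UNIV and n = n, OF _ field_fun.subspace_span]
      by (auto simp: sym_tensor_replicate field_fun.span_base)
  qed (rule field_fun.subspace_span)
  show "field_fun.span (range (\<lambda>v. tpow s v n)) \<subseteq> sympow s n"
    by (intro field_fun.span_minimal subspace_sympow) (auto simp: tpow_mem)
qed

lemma tpow_apply: "multilinear s \<phi> \<Longrightarrow> tpow s v n \<phi> = \<phi> (replicate n v)"
  by (simp add: tpow_def tensor_def)

lemma sympow_cong:
  assumes "T \<in> lin_ops tscale sW (sympow s n) UNIV" "T' \<in> lin_ops tscale sW (sympow s n) UNIV"
    and "\<And>v. T (tpow s v n) = T' (tpow s v n)" and "f \<in> sympow s n"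
  shows "T f = (T' f :: 'b::ab_group_add)"
  using assms(3)
  by (intro lin_ops_span_cong[OF assms(1,2)[unfolded sympow_eq_span_tpow] field_fun.vector_space_axioms
        _ assms(4)[unfolded sympow_eq_span_tpow]]) blast

lemma sympow_into:
  assumes "T \<in> lin_ops tscale sW (sympow s n) UNIV" "vector_space sW" "module.subspace sW W"
    and "\<And>v. T (tpow s v n) \<in> W" and "f \<in> sympow s n"
  shows "T f \<in> (W :: 'b::ab_group_add set)"
  using assms(4)
  by (intro lin_ops_span_into[OF assms(1)[unfolded sympow_eq_span_tpow] field_fun.vector_space_axioms
        assms(2,3) _ assms(5)[unfolded sympow_eq_span_tpow]]) blast

text \<open>
  As the powers \<open>v\<^bsup>\<otimes>n\<^esup>\<close> span, one operator with the prescribed values identifies the chosen one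
  on the whole of \<open>V\<^sup>\<odot>\<^sup>n\<close>.
\<close>

lemma sym_op:
  assumes T: "T \<in> lin_ops tscale sW (sympow s n) UNIV" "\<And>v. T (tpow s v n) = g v"
  shows sym_op_lin: "sym_op s sW n g \<in> lin_ops tscale sW (sympow s n) UNIV"
    and sym_op_tpow: "sym_op s sW n g (tpow s v n) = g v"
    and sym_op_eq: "f \<in> sympow s n \<Longrightarrow> sym_op s sW n g f = (T f :: 'b::ab_group_add)"
proof -
  have *: "sym_op s sW n g \<in> lin_ops tscale sW (sympow s n) UNIV \<and> (\<forall>v. sym_op s sW n g (tpow s v n) = g v)"
    unfolding sym_op_def by (rule someI[of _ T]) (use T in auto)
  then show "sym_op s sW n g \<in> lin_ops tscale sW (sympow s n) UNIV" "sym_op s sW n g (tpow s v n) = g v"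
    by auto
  show "f \<in> sympow s n \<Longrightarrow> sym_op s sW n g f = T f"
    by (rule sympow_cong[OF conjunct1[OF *] T(1)]) (simp_all add: * T(2))
qed

lemma evaluation_lin: "(\<lambda>f. f \<phi>) \<in> lin_ops tscale (*) U UNIV"
  by (auto simp: lin_ops_def fscale_def)

lemma lin_ops_sym_tensor:
  assumes "T \<in> lin_ops tscale sW (sympow s n) UNIV" "length xs + length ys + 1 = n"
  shows "T (sym_tensor s (xs @ (u + v) # ys)) = (T (sym_tensor s (xs @ u # ys)) :: 'b::ab_group_add) + T (sym_tensor s (xs @ v # ys))"
    and "T (sym_tensor s (xs @ s c v # ys)) = sW c (T (sym_tensor s (xs @ v # ys)))"
  using assms by (auto simp: sym_tensor_add sym_tensor_scale lin_ops_add lin_ops_scale sym_tensor_mem)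

section \<open>The product of two functionals\<close>

text \<open>
  Evaluating a symmetric tensor at this form applies the functional \<open>A \<odot> C\<close> to it. Lists of any
  length other than \<open>k + m\<close> are sent to zero, where a multilinear form must be specified as well.
\<close>

definition product_form where
  "product_form k m A C vs = (if length vs = k + m
     then A (sym_tensor s (take k vs)) * C (sym_tensor s (drop k vs)) else 0 :: 'f)"

lemma product_form_multilinear:
  assumes A: "A \<in> lin_ops tscale (*) (sympow s k) UNIV"
    and C: "C \<in> lin_ops tscale (*) (sympow s m) UNIV"
  shows "multilinear s (product_form k m A C)"
proof (rule multilinearI)
  fix xs ys :: "'v list" and u v c
  have "product_form k m A C (xs @ (u + v) # ys) =
      product_form k m A C (xs @ u # ys) + product_form k m A C (xs @ v # ys) \<and>
      product_form k m A C (xs @ s c v # ys) = c * product_form k m A C (xs @ v # ys)"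
  proof (cases "length xs + length ys + 1 = k + m")
    case len: True
    show ?thesis
    proof (cases "length xs < k")
      case True
      then have "take k (xs @ w # ys) = xs @ w # take (k - length xs - 1) ys"
        and "drop k (xs @ w # ys) = drop (k - length xs - 1) ys" for w
        by (simp_all add: take_Cons' drop_Cons')
      then show ?thesis
        using len True lin_ops_sym_tensor[OF A, of xs "take (k - length xs - 1) ys"]
        by (simp add: product_form_def algebra_simps)
    next
      case False
      then have "take k (xs @ w # ys) = take k xs" and "drop k (xs @ w # ys) = drop k xs @ w # ys" for w
        by simp_all
      then show ?thesis
        using len False lin_ops_sym_tensor[OF C, of "drop k xs" ys]
        by (simp add: product_form_def algebra_simps)
    qed
  qed (auto simp: product_form_def)
  then show "product_form k m A C (xs @ (u + v) # ys) =
      product_form k m A C (xs @ u # ys) + product_form k m A C (xs @ v # ys)"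
    and "product_form k m A C (xs @ s c v # ys) = c * product_form k m A C (xs @ v # ys)"
    by auto
qed

lemma sym_op_product:
  assumes A: "A \<in> lin_ops tscale (*) (sympow s k) UNIV"
    and C: "C \<in> lin_ops tscale (*) (sympow s m) UNIV"
  defines "T \<equiv> sym_op s (*) (k + m) (\<lambda>v. A (tpow s v k) * C (tpow s v m))"
  shows "T \<in> lin_ops tscale (*) (sympow s (k + m)) UNIV"
    and "T (tpow s v (k + m)) = A (tpow s v k) * C (tpow s v m)"
    and "f \<in> sympow s (k + m) \<Longrightarrow> T f = f (product_form k m A C)"
proof -
  have "tpow s v (k + m) (product_form k m A C) = A (tpow s v k) * C (tpow s v m)" for v
    using product_form_multilinear[OF A C]
    by (simp add: tpow_apply product_form_def sym_tensor_replicate)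
  note * = sym_op[OF evaluation_lin this]
  show "T \<in> lin_ops tscale (*) (sympow s (k + m)) UNIV"
    and "T (tpow s v (k + m)) = A (tpow s v k) * C (tpow s v m)"
    and "f \<in> sympow s (k + m) \<Longrightarrow> T f = f (product_form k m A C)"
    unfolding T_def using * by auto
qed

section \<open>The product of several vector-valued operators\<close>

text \<open>
  The arguments are cut into blocks of lengths \<open>i\<^sub>1, \<dots>, i\<^sub>m\<close>, to which \<open>B\<^bsub>i\<^sub>1\<^esub>, \<dots>, B\<^bsub>i\<^sub>m\<^esub>\<close> are applied; the
  symmetric product of the results is the multilinear map underlying \<open>B\<^bsub>i\<^sub>1\<^esub> \<odot> \<dots> \<odot> B\<^bsub>i\<^sub>m\<^esub>\<close>.
\<close>

primrec blocks :: "('f, 'v, 'v) fts \<Rightarrow> nat list \<Rightarrow> 'v list \<Rightarrow> 'v list" where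
  "blocks B [] vs = []"
| "blocks B (i # is) vs = B i (sym_tensor s (take i vs)) # blocks B is (drop i vs)"

lemma blocks_replicate:
  "blocks B is (replicate (sum_list is) v) = map (\<lambda>i. B i (tpow s v i)) is"
  by (induction "is") (simp_all add: sym_tensor_replicate)

text \<open>
  A single argument enters exactly one block, hence one entry of the result, and does so linearly;
  this is why the map is multilinear.
\<close>

lemma blocks_middle:
  assumes "length xs + length ys + 1 = sum_list is"
  shows "\<exists>as bs i cs ds. length cs + length ds + 1 = i \<and>
    (\<forall>w. blocks B is (xs @ w # ys) = as @ B i (sym_tensor s (cs @ w # ds)) # bs)"
  using assms
proof (induction "is" arbitrary: xs)
  case (Cons i "is")
  show ?case
  proof (cases "length xs < i")
    case True
    then have "take i (xs @ w # ys) = xs @ w # take (i - length xs - 1) ys"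
      and "drop i (xs @ w # ys) = drop (i - length xs - 1) ys" for w
      by (simp_all add: take_Cons' drop_Cons')
    then show ?thesis
      using True Cons.prems
      by (intro exI[of _ "[]"] exI[of _ "blocks B is (drop (i - length xs - 1) ys)"] exI[of _ i] exI[of _ xs]
          exI[of _ "take (i - length xs - 1) ys"]) simp
  next
    case False
    then have "length (drop i xs) + length ys + 1 = sum_list is"
      using Cons.prems by simp
    from Cons.IH[OF this] obtain as bs j cs ds where
      *: "length cs + length ds + 1 = j"
        "\<And>w. blocks B is (drop i xs @ w # ys) = as @ B j (sym_tensor s (cs @ w # ds)) # bs"
      by (elim exE conjE) simp
    then show ?thesis
      using False
      by (intro exI[of _ "B i (sym_tensor s (take i xs)) # as"] exI[of _ bs] exI[of _ j] exI[of _ cs]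
          exI[of _ ds]) simp
  qed
qed simp

lemma sym_op_prod:
  assumes B: "B \<in> fts s s"
  shows "sym_op_prod s B is \<in> lin_ops tscale tscale (sympow s (sum_list is)) UNIV"
    and "sym_op_prod s B is (tpow s v (sum_list is)) = sym_tensor s (map (\<lambda>i. B i (tpow s v i)) is)"
proof -
  define F where "F = (\<lambda>\<phi> vs. if length vs = sum_list is then sym_tensor s (blocks B is vs) \<phi> else (0::'f))"
  have F: "multilinear s (F \<phi>)" for \<phi>
  proof (rule multilinearI)
    fix xs ys :: "'v list" and u v c
    have "F \<phi> (xs @ (u + v) # ys) = F \<phi> (xs @ u # ys) + F \<phi> (xs @ v # ys) \<and>
        F \<phi> (xs @ s c v # ys) = c * F \<phi> (xs @ v # ys)"
    proof (cases "length xs + length ys + 1 = sum_list is")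
      case True
      from blocks_middle[OF True, of B] obtain as bs i cs ds where
        *: "length cs + length ds + 1 = i" and
        eq: "\<And>w. blocks B is (xs @ w # ys) = as @ B i (sym_tensor s (cs @ w # ds)) # bs"
        by (elim exE conjE) simp
      have "B i \<in> lin_ops tscale s (sympow s i) UNIV"
        using B by (simp add: fts_def)
      from lin_ops_sym_tensor[OF this *] show ?thesis
        using True by (simp add: F_def eq sym_tensor_add sym_tensor_scale fscale_def)
    qed (auto simp: F_def)
    then show "F \<phi> (xs @ (u + v) # ys) = F \<phi> (xs @ u # ys) + F \<phi> (xs @ v # ys)"
      and "F \<phi> (xs @ s c v # ys) = c * F \<phi> (xs @ v # ys)"
      by auto
  qed
  have "(\<lambda>f \<phi>. f (F \<phi>)) \<in> lin_ops tscale tscale (sympow s (sum_list is)) UNIV"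
    by (auto simp: lin_ops_def fscale_def)
  moreover have "(\<lambda>f \<phi>. f (F \<phi>)) (tpow s v (sum_list is)) = sym_tensor s (map (\<lambda>i. B i (tpow s v i)) is)" for v
    by (simp add: tpow_apply[OF F] fun_eq_iff) (simp add: F_def blocks_replicate)
  ultimately show "sym_op_prod s B is \<in> lin_ops tscale tscale (sympow s (sum_list is)) UNIV"
    and "sym_op_prod s B is (tpow s v (sum_list is)) = sym_tensor s (map (\<lambda>i. B i (tpow s v i)) is)"
    unfolding sym_op_prod_def by (rule sym_op)+
qed

section \<open>Linear functionals\<close>

lemma
  assumes "\<omega> \<in> dual s"
  shows dual_add: "\<omega> (u + v) = \<omega> u + \<omega> v" and dual_scale: "\<omega> (s c v) = c * \<omega> v"
  using assms by (auto simp: dual_def Vector_Spaces.linear_iff)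

lemma dualI: "(\<And>u v. \<omega> (u + v) = \<omega> u + \<omega> v) \<Longrightarrow> (\<And>c v. \<omega> (s c v) = c * \<omega> v) \<Longrightarrow> \<omega> \<in> dual s"
  by (simp add: dual_def Vector_Spaces.linear_iff vector_space_field vector_space_axioms)

lemma dual_zero: "\<omega> \<in> dual s \<Longrightarrow> \<omega> 0 = 0"
  using dual_scale[of \<omega> 0 0] by simp

lemma dual_sum: "\<omega> \<in> dual s \<Longrightarrow> \<omega> (\<Sum>i\<in>I. x i) = (\<Sum>i\<in>I. \<omega> (x i))"
  by (induction I rule: infinite_finite_induct) (simp_all add: dual_zero dual_add)

lemma dual_form_multilinear: "\<omega> \<in> dual s \<Longrightarrow> multilinear s (\<lambda>vs. \<Prod>v\<leftarrow>vs. \<omega> v)"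
  by (rule multilinearI) (simp_all add: dual_add dual_scale algebra_simps)

lemma dual_pow_tpow: "\<omega> \<in> dual s \<Longrightarrow> dual_pow \<omega> (tpow s v n) = \<omega> v ^ n"
  by (simp add: dual_pow_def tpow_apply[OF dual_form_multilinear] prod_list_replicate)

lemma dual_pow_lin: "dual_pow \<omega> \<in> lin_ops tscale (*) U UNIV"
  by (auto simp: lin_ops_def fscale_def dual_pow_def)

definition coord :: "'v \<Rightarrow> 'v \<Rightarrow> 'f" where
  "coord b v = representation (extend_basis {}) v b"

lemma basis: "independent (extend_basis {})" "span (extend_basis {}) = UNIV"
  using independent_extend_basis[OF independent_empty] span_extend_basis[OF independent_empty] by auto

lemma coord_dual: "coord b \<in> dual s"
  unfolding coord_def by (intro dualI) (simp_all add: representation_add representation_scale basis)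

lemma finite_coord: "finite {b. coord b v \<noteq> 0}"
  unfolding coord_def by (rule finite_representation)

lemma sum_coord: "finite E \<Longrightarrow> {b. coord b v \<noteq> 0} \<subseteq> E \<Longrightarrow> (\<Sum>b\<in>E. s (coord b v) b) = v"
proof -
  assume E: "finite E" "{b. coord b v \<noteq> 0} \<subseteq> E"
  have "(\<Sum>b\<in>E. s (coord b v) b) = (\<Sum>b | coord b v \<noteq> 0. s (coord b v) b)"
    using E by (intro sum.mono_neutral_right) auto
  also have "\<dots> = v"
    unfolding coord_def by (rule sum_nonzero_representation_eq) (simp_all add: basis)
  finally show ?thesis .
qed

lemma dual_separates:
  assumes "\<And>\<omega>. \<omega> \<in> dual s \<Longrightarrow> \<omega> u = \<omega> v"
  shows "u = v"
proof -
  have c: "coord b u = coord b v" for b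
    using assms coord_dual by blast
  have "(\<Sum>b | coord b u \<noteq> 0. s (coord b u) b) = u" "(\<Sum>b | coord b v \<noteq> 0. s (coord b v) b) = v"
    by (rule sum_coord[OF finite_coord order_refl])+
  then show ?thesis unfolding c by simp
qed

text \<open>
  \<open>V\<^sup>\<odot>\<^sup>1\<close> consists of the tensors \<open>v\<^bsup>\<otimes>1\<^esup>\<close> only, and \<open>v\<close> can be recovered from \<open>v\<^bsup>\<otimes>1\<^esup>\<close> because linear
  functionals separate vectors.
\<close>

lemma sym_op_identity: "sym_op s s 1 (\<lambda>v. v) (tpow s v 1) = v"
proof -
  have inj: "u = v" if "tpow s u 1 = tpow s v 1" for u v
    using that by (intro dual_separates) (metis dual_pow_tpow power_one_right)
  have add: "tpow s (u + v) 1 = tpow s u 1 + tpow s v 1" for u v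
    using sym_tensor_add[of "[]" u v "[]"] by (simp add: sym_tensor_replicate[symmetric])
  have scale: "tpow s (s c v) 1 = tscale c (tpow s v 1)" for c v
    using sym_tensor_scale[of "[]" c v "[]"] by (simp add: sym_tensor_replicate[symmetric])
  have rng: "sympow s 1 = range (\<lambda>v. tpow s v 1)"
    unfolding sympow_eq_span_tpow
  proof (rule field_fun.span_eq_iff[THEN iffD2], rule field_fun.subspaceI)
    show "0 \<in> range (\<lambda>v. tpow s v 1)"
      using scale[of 0 0] by (metis rangeI field_fun.scale_zero_left)
  qed (auto simp: add[symmetric] scale[symmetric] simp del: One_nat_def)
  define T where "T f = (THE v. f = tpow s v 1)" for f
  have T: "T (tpow s v 1) = v" for v
    unfolding T_def using inj by (intro the_equality) auto
  have "T \<in> lin_ops tscale s (sympow s 1) UNIV"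
    unfolding rng by (intro lin_opsI) (auto simp: add[symmetric] scale[symmetric] T simp del: One_nat_def)
  from sym_op_tpow[OF this T] show ?thesis .
qed

section \<open>Polynomials on the dual space\<close>

lemma sympow_representation:
  assumes "f \<in> sympow s n"
  obtains I :: "('f, 'v) tensor set" and c v
    where "finite I" "f = (\<Sum>i\<in>I. tscale (c i) (tpow s (v i) n))"
proof -
  from assms obtain t r where t: "finite t" "t \<subseteq> range (\<lambda>v. tpow s v n)" "f = (\<Sum>a\<in>t. tscale (r a) a)"
    unfolding sympow_eq_span_tpow field_fun.span_explicit by auto
  have "\<forall>a\<in>t. \<exists>v. a = tpow s v n" using t(2) by auto
  then obtain v where "\<forall>a\<in>t. a = tpow s (v a) n" by (rule bchoice[THEN exE])
  then have "f = (\<Sum>a\<in>t. tscale (r a) (tpow s (v a) n))"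
    unfolding t(3) by (intro sum.cong) auto
  with t(1) show ?thesis by (rule that)
qed

lemma multilinear_Cons: "multilinear s \<phi> \<Longrightarrow> multilinear s (\<lambda>vs. \<phi> (b # vs))"
  unfolding multilinear_def by (metis append_Cons)

lemma multilinear_sum:
  assumes "multilinear s \<phi>"
  shows "\<phi> ((\<Sum>b\<in>E. s (a b) b) # ys) = (\<Sum>b\<in>E. a b * \<phi> (b # ys))"
proof -
  have "\<phi> (0 # ys) = 0"
    using multilinear_scale[OF assms, of "[]" 0 0 ys] by simp
  then show ?thesis
    using multilinear_add[OF assms, of "[]"] multilinear_scale[OF assms, of "[]"]
    by (induction E rule: infinite_finite_induct) simp_all
qed

text \<open>
  Polarization on the dual space turns the hypothesis into
  \<open>\<Sum>\<^sub>i c\<^sub>i \<eta>\<^sub>1(v\<^sub>i) \<dots> \<eta>\<^sub>n(v\<^sub>i) = 0\<close> for all linear functionals \<open>\<eta>\<^sub>1, \<dots>, \<eta>\<^sub>n\<close>. The arguments of \<open>\<phi>\<close> are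
  then exchanged for functionals one at a time: expanding the first argument in a basis replaces
  \<open>\<phi>(v\<^sub>i, \<dots>)\<close> by the sum of \<open>b\<^sup>*(v\<^sub>i) \<phi>(b, \<dots>)\<close>, and \<open>\<phi>(b, \<dots>)\<close> has one argument less. Only finitely
  many basis vectors occur, so this works in any dimension.
\<close>

lemma vanishing_of_powers:
  assumes fin: "finite I"
    and zero: "\<And>\<omega>. \<omega> \<in> dual s \<Longrightarrow> (\<Sum>i\<in>I. c i * \<omega> (v i) ^ n) = 0"
    and \<phi>: "multilinear s \<phi>"
  shows "(\<Sum>i\<in>I. c i * \<phi> (replicate n (v i))) = 0"
proof -
  define M where "M \<eta>s = (\<Sum>i\<in>I. c i * (\<Prod>\<eta>\<leftarrow>\<eta>s. \<eta> (v i)))" for \<eta>s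
  have M: "symmetric_multilinear (fscale (*)) (*) M"
  proof (intro symmetric_multilinear.intro field_fun.vector_space_axioms vector_space_field
      symmetric_multilinear_axioms.intro)
    show "M xs = M ys" if "mset xs = mset ys" for xs ys
    proof -
      have "(\<Prod>\<eta>\<leftarrow>xs. \<eta> (v i)) = (\<Prod>\<eta>\<leftarrow>ys. \<eta> (v i))" for i
        using arg_cong[OF that, of "\<lambda>m. prod_mset (image_mset (\<lambda>\<eta>. \<eta> (v i)) m)"]
        by (simp only: mset_map[symmetric] prod_mset_prod_list)
      then show ?thesis by (simp add: M_def)
    qed
  qed (simp_all add: M_def fscale_def algebra_simps sum.distrib sum_distrib_left)
  have M0: "M \<eta>s = 0" if "set \<eta>s \<subseteq> dual s" "length \<eta>s = n" for \<eta>s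
  proof -
    have "M \<eta>s \<in> {0}"
    proof (rule symmetric_multilinear.polarization[OF M, where C = "dual s" and n = n])
      show "u + fscale (*) t w \<in> dual s" if "u \<in> dual s" "w \<in> dual s" for u w t
        using that by (intro dualI) (simp_all add: fscale_def dual_add dual_scale algebra_simps)
      show "M (replicate n u) \<in> {0}" if "u \<in> dual s" for u
        using zero[OF that] by (simp add: M_def prod_list_replicate)
      show "0 \<in> dual s" by (rule dualI) simp_all
    qed (use that in \<open>simp_all add: subspace_zero_field\<close>)
    then show ?thesis by simp
  qed
  have "(\<Sum>i\<in>I. c i * (\<Prod>\<eta>\<leftarrow>\<eta>s. \<eta> (v i)) * \<phi> (replicate j (v i))) = 0"
    if "set \<eta>s \<subseteq> dual s" "length \<eta>s + j = n" "multilinear s \<phi>" for \<eta>s j \<phi>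
    using that
  proof (induction j arbitrary: \<eta>s \<phi>)
    case 0
    then show ?case
      using M0[of \<eta>s] by (simp add: M_def sum_distrib_right[symmetric])
  next
    case (Suc j)
    define E where "E = (\<Union>i\<in>I. {b. coord b (v i) \<noteq> 0})"
    have E: "finite E" unfolding E_def by (intro finite_UN_I fin finite_coord)
    have "\<phi> (replicate (Suc j) (v i)) = (\<Sum>b\<in>E. coord b (v i) * \<phi> (b # replicate j (v i)))" if "i \<in> I" for i
    proof -
      have "(\<Sum>b\<in>E. s (coord b (v i)) b) = v i"
        using that by (intro sum_coord[OF E]) (auto simp: E_def)
      then show ?thesis
        using multilinear_sum[OF Suc.prems(3), where E = E and a = "\<lambda>b. coord b (v i)" and ys = "replicate j (v i)"]
        by simp
    qed
    then have "(\<Sum>i\<in>I. c i * (\<Prod>\<eta>\<leftarrow>\<eta>s. \<eta> (v i)) * \<phi> (replicate (Suc j) (v i))) =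
        (\<Sum>i\<in>I. \<Sum>b\<in>E. c i * (\<Prod>\<eta>\<leftarrow>coord b # \<eta>s. \<eta> (v i)) * \<phi> (b # replicate j (v i)))"
      by (intro sum.cong refl) (simp add: sum_distrib_left mult_ac)
    also have "\<dots> = (\<Sum>b\<in>E. \<Sum>i\<in>I. c i * (\<Prod>\<eta>\<leftarrow>coord b # \<eta>s. \<eta> (v i)) * \<phi> (b # replicate j (v i)))"
      by (rule sum.swap)
    also have "\<dots> = 0"
      using Suc.prems
      by (intro sum.neutral ballI Suc.IH multilinear_Cons) (auto simp: coord_dual)
    finally show ?case .
  qed
  from this[of "[]" n \<phi>] \<phi> show ?thesis by simp
qed

lemma dual_pow_eq_0:
  assumes f: "f \<in> sympow s n" and zero: "\<And>\<omega>. \<omega> \<in> dual s \<Longrightarrow> dual_pow \<omega> f = 0"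
  shows "f = 0"
proof
  fix \<phi>
  obtain I :: "('f, 'v) tensor set" and c v
    where I: "finite I" "f = (\<Sum>i\<in>I. tscale (c i) (tpow s (v i) n))"
    using sympow_representation[OF f] .
  have app: "f \<phi> = (\<Sum>i\<in>I. c i * tpow s (v i) n \<phi>)" for \<phi>
    by (simp add: I(2) sum_fun_apply fscale_def)
  show "f \<phi> = 0 \<phi>"
  proof (cases "multilinear s \<phi>")
    case True
    have "(\<Sum>i\<in>I. c i * \<omega> (v i) ^ n) = 0" if "\<omega> \<in> dual s" for \<omega>
      using zero[OF that] app[of "\<lambda>vs. \<Prod>v\<leftarrow>vs. \<omega> v"] dual_pow_tpow[OF that]
      unfolding dual_pow_def by simp
    from vanishing_of_powers[OF I(1) this True] show ?thesis
      by (simp add: app tpow_apply[OF True])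
  next
    case False
    then show ?thesis by (simp add: app tpow_def tensor_def)
  qed
qed

lemma dual_pow_homogeneous:
  assumes "\<omega> \<in> dual s" "f \<in> sympow s n"
  shows "dual_pow (\<lambda>v. t * \<omega> v) f = t ^ n * dual_pow \<omega> f"
proof (rule sympow_cong[OF _ _ _ assms(2)])
  show "dual_pow (\<lambda>v. t * \<omega> v) \<in> lin_ops tscale (*) (sympow s n) UNIV" by (rule dual_pow_lin)
  show "(\<lambda>f. t ^ n * dual_pow \<omega> f) \<in> lin_ops tscale (*) (sympow s n) UNIV"
    by (rule lin_opsI) (simp_all add: dual_pow_def fscale_def algebra_simps)
  have "(\<lambda>v. t * \<omega> v) \<in> dual s"
    by (intro dualI) (simp_all add: dual_add dual_scale assms algebra_simps)
  then show "dual_pow (\<lambda>v. t * \<omega> v) (tpow s v n) = t ^ n * dual_pow \<omega> (tpow s v n)" for v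
    by (simp add: dual_pow_tpow assms(1) power_mult_distrib)
qed

text \<open>
  Replacing \<open>\<omega>\<close> by \<open>t \<omega>\<close> separates the homogeneous components, which reduces the claim to a single
  degree.
\<close>

lemma polynomial_components_unique:
  assumes f: "\<And>k. f k \<in> sympow s k"
    and zero: "\<And>\<omega>. \<omega> \<in> dual s \<Longrightarrow> (\<Sum>k\<le>n. dual_pow \<omega> (f k)) = 0" and k: "k \<le> n"
  shows "f k = 0"
proof (rule dual_pow_eq_0[OF f])
  fix \<omega> assume \<omega>: "\<omega> \<in> dual s"
  have "\<forall>k\<le>n. dual_pow \<omega> (f k) \<in> {0}"
  proof (rule vector_space.subspace_polynomial_coeffs[OF vector_space_field _ subspace_zero_field])
    fix t
    have "(\<lambda>v. t * \<omega> v) \<in> dual s"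
      by (intro dualI) (simp_all add: dual_add dual_scale \<omega> algebra_simps)
    from zero[OF this] show "(\<Sum>k\<le>n. t ^ k * dual_pow \<omega> (f k)) \<in> {0}"
      by (simp add: dual_pow_homogeneous[OF \<omega> f])
  qed (rule of_nat_neq_0)
  with k show "dual_pow \<omega> (f k) = 0" by simp
qed

definition monomial :: "('f, 'v) tensor \<Rightarrow> ('v \<Rightarrow> 'f) \<Rightarrow> 'f" where
  "monomial f = on_dual s (\<lambda>\<omega>. dual_pow \<omega> f)"

lemma monomial_apply: "\<omega> \<in> dual s \<Longrightarrow> monomial f \<omega> = dual_pow \<omega> f"
  by (simp add: monomial_def on_dual_def)

lemma monomial_outside: "\<omega> \<notin> dual s \<Longrightarrow> monomial f \<omega> = 0"
  by (simp add: monomial_def on_dual_def)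

lemma monomial_lin: "monomial \<in> lin_ops tscale (fscale (*)) U UNIV"
  by (rule lin_opsI) (auto simp: monomial_def on_dual_def fscale_def dual_pow_def fun_eq_iff)

lemma on_dual_sum: "on_dual s (\<lambda>\<omega>. \<Sum>k\<in>K. dual_pow \<omega> (f k)) = (\<Sum>k\<in>K. monomial (f k))"
  by (auto simp: fun_eq_iff sum_fun_apply on_dual_def monomial_def)

text \<open>
  Requiring \<open>f\<^sub>k\<close> to vanish beyond the degree bound makes \<open>f\<close> unique and allows the bound to be
  raised.
\<close>

definition components :: "(('v \<Rightarrow> 'f) \<Rightarrow> 'f) \<Rightarrow> (nat \<Rightarrow> ('f, 'v) tensor) \<Rightarrow> nat \<Rightarrow> bool" where
  "components p f n \<longleftrightarrow> (\<forall>k. f k \<in> sympow s k) \<and> (\<forall>k>n. f k = 0) \<and> p = (\<Sum>k\<le>n. monomial (f k))"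

lemma zero_mem: "0 \<in> sympow s k"
  by (rule field_fun.subspace_0[OF subspace_sympow])

lemma monomial_0: "monomial 0 = 0"
  by (simp add: monomial_def dual_pow_def on_dual_def fun_eq_iff)

lemma polys_iff: "p \<in> polys s \<longleftrightarrow> (\<exists>f n. components p f n)"
proof
  assume "p \<in> polys s"
  then obtain n f where *: "p = (\<Sum>k\<le>n. monomial (f k))" "\<forall>k\<le>n. f k \<in> sympow s k"
    by (auto simp: polys_def on_dual_sum)
  have "components p (\<lambda>k. if k \<le> n then f k else 0) n"
    unfolding components_def *(1) using *(2) by (auto simp: zero_mem intro!: sum.cong)
  then show "\<exists>f n. components p f n" by blast
next
  assume "\<exists>f n. components p f n"
  then show "p \<in> polys s"
    by (auto simp: polys_def on_dual_sum components_def)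
qed

lemma components_mono:
  assumes "components p f n" "n \<le> m"
  shows "components p f m"
proof -
  have "(\<Sum>k\<le>n. monomial (f k)) = (\<Sum>k\<le>m. monomial (f k))"
    using assms by (intro sum.mono_neutral_left) (auto simp: components_def monomial_0)
  then show ?thesis using assms by (auto simp: components_def)
qed

lemma components_unique:
  assumes "components p f n" "components p g n"
  shows "f k = g k"
proof (cases "k \<le> n")
  case True
  have "f k - g k = 0"
  proof (rule polynomial_components_unique[OF _ _ True])
    show "f k - g k \<in> sympow s k" for k
      using assms by (intro field_fun.subspace_diff[OF subspace_sympow]) (auto simp: components_def)
    fix \<omega> assume \<omega>: "\<omega> \<in> dual s"
    have "(\<Sum>k\<le>n. monomial (f k)) \<omega> = (\<Sum>k\<le>n. monomial (g k)) \<omega>"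
      using assms by (simp add: components_def)
    then show "(\<Sum>k\<le>n. dual_pow \<omega> (f k - g k)) = 0"
      using \<omega> by (simp add: sum_fun_apply monomial_apply dual_pow_def sum_subtractf)
  qed
  then show ?thesis by simp
qed (use assms in \<open>auto simp: components_def\<close>)

lemma components_add:
  assumes "components p f n" "components q g n"
  shows "components (p + q) (\<lambda>k. f k + g k) n"
  using assms
  by (auto simp: components_def sum.distrib lin_ops_add[OF monomial_lin[of UNIV]]
      intro!: field_fun.subspace_add[OF subspace_sympow])

lemma components_scale:
  assumes "components p f n"
  shows "components (fscale (*) c p) (\<lambda>k. tscale c (f k)) n"
  using assms
  by (auto simp: components_def lin_ops_scale[OF monomial_lin[of UNIV]] field_fun.scale_sum_right
      intro!: field_fun.subspace_scale[OF subspace_sympow])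

lemma subspace_polys: "field_fun.subspace (polys s)"
proof (rule field_fun.subspaceI)
  have "components 0 (\<lambda>k. 0) 0"
    by (simp add: components_def zero_mem monomial_0)
  then show "0 \<in> polys s" unfolding polys_iff by blast
  fix p q assume "p \<in> polys s" "q \<in> polys s"
  then obtain f n g m where "components p f n" "components q g m" unfolding polys_iff by blast
  then have "components p f (max n m)" "components q g (max n m)"
    by (auto elim: components_mono)
  then show "p + q \<in> polys s"
    unfolding polys_iff by (blast intro: components_add)
next
  fix c p assume "p \<in> polys s"
  then show "fscale (*) c p \<in> polys s"
    unfolding polys_iff by (blast intro: components_scale)
qed

lemma monomial_mem: "f \<in> sympow s n \<Longrightarrow> monomial f \<in> polys s"
  unfolding polys_iff
  by (intro exI[of _ "\<lambda>k. if k = n then f else 0"] exI[of _ n])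
    (auto simp: components_def zero_mem monomial_0 if_distrib sum.delta cong: if_cong)

lemma polys_eq_span: "polys s = field_fun.span {monomial (tpow s v n) | v n. True}"
proof (rule antisym)
  show "polys s \<subseteq> field_fun.span {monomial (tpow s v n) | v n. True}"
  proof
    fix p assume "p \<in> polys s"
    then obtain f n where f: "\<And>k. f k \<in> sympow s k" "p = (\<Sum>k\<le>n. monomial (f k))"
      unfolding polys_iff components_def by blast
    have "monomial (f k) \<in> field_fun.span {monomial (tpow s v n) | v n. True}" for k
      by (rule sympow_into[OF monomial_lin field_fun.vector_space_axioms field_fun.subspace_span _ f(1)])
        (auto intro: field_fun.span_base)
    then show "p \<in> field_fun.span {monomial (tpow s v n) | v n. True}"
      unfolding f(2) by (intro field_fun.span_sum)
  qed
  show "field_fun.span {monomial (tpow s v n) | v n. True} \<subseteq> polys s"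
    by (intro field_fun.span_minimal subspace_polys) (auto intro: monomial_mem tpow_mem)
qed

lemma polys_induct [consumes 1, case_names zero step]:
  assumes "p \<in> polys s" and "P 0"
    and "\<And>c v n q. q \<in> polys s \<Longrightarrow> P q \<Longrightarrow> P (fscale (*) c (monomial (tpow s v n)) + q)"
  shows "P p"
proof -
  have "p \<in> polys s \<and> P p"
  proof (rule field_fun.span_induct_alt[where h = "\<lambda>p. p \<in> polys s \<and> P p"])
    show "p \<in> field_fun.span {monomial (tpow s v n) | v n. True}"
      using assms(1) by (simp only: polys_eq_span)
    show "0 \<in> polys s \<and> P 0"
      by (intro conjI field_fun.subspace_0[OF subspace_polys] assms(2))
  next
    fix c x y
    assume "x \<in> {monomial (tpow s v n) | v n. True}" and y: "y \<in> polys s \<and> P y"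
    then obtain v n where x: "x = monomial (tpow s v n)" by blast
    then show "fscale (*) c x + y \<in> polys s \<and> P (fscale (*) c x + y)"
      unfolding x using y
      by (intro conjI assms(3) field_fun.subspace_add[OF subspace_polys]
          field_fun.subspace_scale[OF subspace_polys] monomial_mem[OF tpow_mem]) simp_all
  qed
  then show ?thesis by simp
qed

section \<open>The derivatives of a polynomial\<close>

definition falling :: "nat \<Rightarrow> nat \<Rightarrow> 'f" where
  "falling n k = (\<Prod>i<k. of_nat n - of_nat i)"

lemma falling_eq_0: "n < k \<Longrightarrow> falling n k = 0"
  unfolding falling_def by (intro prod_zero) auto

lemma falling_eq_fact: "k \<le> n \<Longrightarrow> falling n k = fact n / fact (n - k)"
proof (induction k)
  case (Suc k)
  have "fact (n - k) = (of_nat n - of_nat k) * (fact (n - Suc k) :: 'f)"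
    using Suc.prems by (subst fact_reduce) (simp_all add: of_nat_diff)
  moreover have "of_nat n - of_nat k \<noteq> (0 :: 'f)"
    using Suc.prems by simp
  ultimately show ?case
    using Suc by (simp add: falling_def)
qed (simp add: falling_def)

text \<open>
  The action of \<open>D\<^sup>k\<close> on the homogeneous component of degree \<open>n\<close>: \<open>n - k\<close> of the arguments are paired
  with \<open>\<omega>\<close> and the other \<open>k\<close> stay. For \<open>k > n\<close> the factor \<open>n (n - 1) \<dots> (n - k + 1)\<close> vanishes.
\<close>

definition contract :: "nat \<Rightarrow> nat \<Rightarrow> ('v \<Rightarrow> 'f) \<Rightarrow> ('f, 'v) tensor \<Rightarrow> ('f, 'v) tensor" where
  "contract k n \<omega> f = tscale (falling n k) (\<lambda>\<phi>. f (product_form (n - k) k (dual_pow \<omega>) (\<lambda>g. g \<phi>)))"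

lemma contract_add: "contract k n \<omega> (f + g) = contract k n \<omega> f + contract k n \<omega> g"
  and contract_scale: "contract k n \<omega> (tscale c f) = tscale c (contract k n \<omega> f)"
  by (auto simp: contract_def fscale_def fun_eq_iff algebra_simps)

lemma contract_0: "contract k n \<omega> 0 = 0"
  by (auto simp: contract_def fscale_def fun_eq_iff)

lemma contract_tpow:
  assumes "\<omega> \<in> dual s"
  shows "contract k n \<omega> (tpow s v n) = tscale (falling n k * \<omega> v ^ (n - k)) (tpow s v k)"
proof (cases "k \<le> n")
  case True
  have "multilinear s (product_form (n - k) k (dual_pow \<omega>) (\<lambda>g. g \<phi>))" for \<phi>
    by (intro product_form_multilinear dual_pow_lin evaluation_lin)
  then have "tpow s v n (product_form (n - k) k (dual_pow \<omega>) (\<lambda>g. g \<phi>)) = \<omega> v ^ (n - k) * tpow s v k \<phi>" for \<phi>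
    using True by (simp add: tpow_apply product_form_def sym_tensor_replicate dual_pow_tpow[OF assms])
  then show ?thesis
    by (simp add: contract_def fscale_def mult.assoc)
next
  case False
  then show ?thesis
    by (simp add: contract_def fscale_def falling_eq_0 fun_eq_iff)
qed

lemma power_polynomial: "on_dual s (\<lambda>\<omega>. c * \<omega> v ^ n) \<in> polys s"
proof -
  have "on_dual s (\<lambda>\<omega>. c * \<omega> v ^ n) = fscale (*) c (monomial (tpow s v n))"
    by (auto simp: on_dual_def fscale_def fun_eq_iff monomial_def dual_pow_tpow)
  then show ?thesis
    by (simp add: field_fun.subspace_scale[OF subspace_polys] monomial_mem[OF tpow_mem])
qed

text \<open>
  Any decomposition into homogeneous components may be used, as there is only one; this
  operator witnesses the existence of \<open>D\<^sup>k\<close>.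
\<close>

definition derivation :: "nat \<Rightarrow> (('v \<Rightarrow> 'f) \<Rightarrow> 'f) \<Rightarrow> ('v \<Rightarrow> 'f) \<Rightarrow> ('f, 'v) tensor" where
  "derivation k p = (SOME q. \<exists>f n. components p f n \<and> q = on_dual s (\<lambda>\<omega>. \<Sum>m\<le>n. contract k m \<omega> (f m)))"

lemma derivation_eq:
  assumes "components p f n"
  shows "derivation k p = on_dual s (\<lambda>\<omega>. \<Sum>m\<le>n. contract k m \<omega> (f m))"
proof -
  have eq: "(\<Sum>m\<le>n. contract k m \<omega> (f m)) = (\<Sum>m\<le>n'. contract k m \<omega> (g m))"
    if g: "components p g n'" for g n' \<omega>
  proof -
    define N where "N = max n n'"
    have "f m = g m" for m
      using components_unique[of p f N g] components_mono[OF assms] components_mono[OF g] by (simp add: N_def)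
    moreover have "(\<Sum>m\<le>n. contract k m \<omega> (f m)) = (\<Sum>m\<le>N. contract k m \<omega> (f m))"
      using assms by (intro sum.mono_neutral_left) (auto simp: components_def contract_0 N_def)
    moreover have "(\<Sum>m\<le>n'. contract k m \<omega> (g m)) = (\<Sum>m\<le>N. contract k m \<omega> (g m))"
      using g by (intro sum.mono_neutral_left) (auto simp: components_def contract_0 N_def)
    ultimately show ?thesis by simp
  qed
  have "\<exists>f n. components p f n \<and> derivation k p = on_dual s (\<lambda>\<omega>. \<Sum>m\<le>n. contract k m \<omega> (f m))"
    unfolding derivation_def
    by (rule someI_ex[of "\<lambda>q. \<exists>f n. components p f n \<and> q = on_dual s (\<lambda>\<omega>. \<Sum>m\<le>n. contract k m \<omega> (f m))"])
      (rule exI, rule exI, rule exI, rule conjI, rule assms, rule refl)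
  then show ?thesis using eq by auto
qed

lemma derivation_lin:
  "derivation k \<in> lin_ops (fscale (*)) (fscale tscale) (polys s) (polys_into s tscale (sympow s k))"
proof (rule lin_opsI)
  interpret tfun: vector_space "fscale tscale :: 'f \<Rightarrow> (('v \<Rightarrow> 'f) \<Rightarrow> ('f, 'v) tensor) \<Rightarrow> _"
    by (intro vector_space_fscale field_fun.vector_space_axioms)
  fix p assume "p \<in> polys s"
  then obtain f n where f: "components p f n" unfolding polys_iff by blast
  let ?T = "\<lambda>m f. on_dual s (\<lambda>\<omega>. contract k m \<omega> f)"
  have "?T m (f m) \<in> polys_into s tscale (sympow s k)" for m
    unfolding polys_into_def
  proof (rule sympow_into[where T = "?T m" and n = m, OF _ tfun.vector_space_axioms tfun.subspace_span])
    show "?T m \<in> lin_ops tscale (fscale tscale) (sympow s m) UNIV"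
      by (rule lin_opsI) (auto simp: on_dual_def contract_add contract_scale fun_eq_iff fscale_def[of tscale])
    show "f m \<in> sympow s m" using f by (simp add: components_def)
    fix v
    have "?T m (tpow s v m) = (\<lambda>\<omega>. tscale (on_dual s (\<lambda>\<omega>. falling m k * \<omega> v ^ (m - k)) \<omega>) (tpow s v k))"
      by (auto simp: on_dual_def contract_tpow fun_eq_iff fscale_def)
    then show "?T m (tpow s v m) \<in> tfun.span {\<lambda>\<omega>. tscale (p \<omega>) w |p w. p \<in> polys s \<and> w \<in> sympow s k}"
      by (intro tfun.span_base) (use power_polynomial tpow_mem in blast)
  qed
  then have "(\<Sum>m\<le>n. ?T m (f m)) \<in> polys_into s tscale (sympow s k)"
    unfolding polys_into_def by (intro tfun.span_sum)
  also have "(\<Sum>m\<le>n. ?T m (f m)) = derivation k p"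
    unfolding derivation_eq[OF f] by (auto simp: fun_eq_iff on_dual_def sum_fun_apply)
  finally show "derivation k p \<in> polys_into s tscale (sympow s k)" .
next
  fix p q assume "p \<in> polys s" "q \<in> polys s"
  then obtain f n g m where "components p f n" "components q g m" unfolding polys_iff by blast
  then have f: "components p f (max n m)" and g: "components q g (max n m)"
    by (auto elim: components_mono)
  show "derivation k (p + q) = derivation k p + derivation k q"
    unfolding derivation_eq[OF f] derivation_eq[OF g] derivation_eq[OF components_add[OF f g]]
    by (auto simp: on_dual_def fun_eq_iff contract_add sum.distrib)
next
  fix c p assume "p \<in> polys s"
  then obtain f n where f: "components p f n" unfolding polys_iff by blast
  show "derivation k (fscale (*) c p) = fscale tscale c (derivation k p)"
    unfolding derivation_eq[OF f] derivation_eq[OF components_scale[OF f]] contract_scale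
    by (auto simp: on_dual_def fun_eq_iff sum_distrib_left fscale_def sum_fun_apply)
qed

lemma
  shows Dop_lin: "Dop s k \<in> lin_ops (fscale (*)) (fscale tscale) (polys s) (polys_into s tscale (sympow s k))"
    and Dop_tpow: "\<omega> \<in> dual s \<Longrightarrow>
      Dop s k (monomial (tpow s v n)) \<omega> = tscale (falling n k * \<omega> v ^ (n - k)) (tpow s v k)"
proof -
  have "derivation k (monomial (tpow s v n)) \<omega> = tscale (falling n k * \<omega> v ^ (n - k)) (tpow s v k)"
    if "\<omega> \<in> dual s" for v n \<omega>
  proof -
    have "components (monomial (tpow s v n)) (\<lambda>k. if k = n then tpow s v n else 0) n"
      by (auto simp: components_def zero_mem tpow_mem monomial_0 if_distrib sum.delta cong: if_cong)
    from derivation_eq[OF this] that show ?thesis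
      by (simp add: on_dual_def if_distrib[of "contract k _ _"] contract_0 contract_tpow cong: if_cong)
  qed
  then have "\<exists>D. D \<in> lin_ops (fscale (*)) (fscale tscale) (polys s) (polys_into s tscale (sympow s k)) \<and>
     (\<forall>n v. \<forall>\<omega>\<in>dual s. D (on_dual s (\<lambda>\<omega>'. dual_pow \<omega>' (tpow s v n))) \<omega> =
        tscale ((\<Prod>i<k. of_nat n - of_nat i) * \<omega> v ^ (n - k)) (tpow s v k))"
    using derivation_lin unfolding monomial_def falling_def by blast
  from someI_ex[OF this]
  show "Dop s k \<in> lin_ops (fscale (*)) (fscale tscale) (polys s) (polys_into s tscale (sympow s k))"
    and "\<omega> \<in> dual s \<Longrightarrow>
      Dop s k (monomial (tpow s v n)) \<omega> = tscale (falling n k * \<omega> v ^ (n - k)) (tpow s v k)"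
    unfolding Dop_def monomial_def falling_def by auto
qed

lemma Dop_combination:
  assumes "q \<in> polys s" "\<omega> \<in> dual s"
  shows "Dop s k (fscale (*) c (monomial (tpow s v n)) + q) \<omega> =
    tscale (c * falling n k * \<omega> v ^ (n - k)) (tpow s v k) + Dop s k q \<omega>"
proof -
  have m: "monomial (tpow s v n) \<in> polys s" by (rule monomial_mem[OF tpow_mem])
  show ?thesis
    using assms m
    by (simp add: lin_ops_add[OF Dop_lin] lin_ops_scale[OF Dop_lin] field_fun.subspace_scale[OF subspace_polys]
        fscale_def[of tscale] Dop_tpow mult.assoc)
qed

lemma Dop_0: "Dop s k 0 = 0"
  by (rule lin_ops_zero[OF Dop_lin field_fun.vector_space_axioms subspace_polys])

lemma Dop_mem: "p \<in> polys s \<Longrightarrow> \<omega> \<in> dual s \<Longrightarrow> Dop s k p \<omega> \<in> sympow s k"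
  by (induction rule: polys_induct)
    (simp_all add: Dop_0 zero_mem Dop_combination field_fun.subspace_add[OF subspace_sympow]
      field_fun.subspace_scale[OF subspace_sympow] tpow_mem)

lemma Dop_eventually_0: "p \<in> polys s \<Longrightarrow> \<exists>N. \<forall>k>N. \<forall>\<omega>\<in>dual s. Dop s k p \<omega> = 0"
proof (induction rule: polys_induct)
  case (step c v n q)
  then obtain N where N: "\<forall>k>N. \<forall>\<omega>\<in>dual s. Dop s k q \<omega> = 0" by blast
  show ?case
  proof (intro exI[of _ "max n N"] allI impI ballI)
    fix k \<omega> assume "max n N < k" and \<omega>: "\<omega> \<in> dual s"
    then show "Dop s k (fscale (*) c (monomial (tpow s v n)) + q) \<omega> = 0"
      unfolding Dop_combination[OF step(1) \<omega>] using N by (simp add: falling_eq_0)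
  qed
next
  case zero
  show ?case
    by (intro exI[of _ 0] allI impI ballI) (rule trans[OF fun_cong[OF Dop_0] zero_fun_apply])
qed

lemma tpow_0: "tpow s v 0 = tensor s []"
  by (simp add: tpow_def)

text \<open>
  Every sufficiently long initial segment of the series computes the operator. Unlike the support
  of \<open>k \<mapsto> D\<^sup>k p\<close>, such a segment can be chosen for two polynomials at once, which makes linearity
  in the polynomial visible.
\<close>

lemma fts_op_eq:
  assumes G: "G \<in> fts s sW" and p: "p \<in> polys s" "\<omega> \<in> dual s"
    and N: "\<And>k. k > N \<Longrightarrow> Dop s k p \<omega> = 0"
  shows "fts_op s sW G p \<omega> = sW (p \<omega>) (G 0 (tensor s [])) + (\<Sum>k=1..N. G k (Dop s k p \<omega>))"
proof -
  have "G k 0 = 0" for k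
    using G by (intro lin_ops_zero[OF _ field_fun.vector_space_axioms subspace_sympow]) (auto simp: fts_def)
  then have "(\<Sum>k | 1 \<le> k \<and> Dop s k p \<omega> \<noteq> 0. G k (Dop s k p \<omega>)) = (\<Sum>k=1..N. G k (Dop s k p \<omega>))"
    using N by (intro sum.mono_neutral_left) (auto simp: not_less[symmetric])
  then show ?thesis by (simp add: fts_op_def)
qed

text \<open>
  Linearity, in the form of one step of the induction over the span of the powers. The constant
  term of \<open>G\<close> becomes the summand for \<open>k = 0\<close>.
\<close>

lemma fts_op_combination:
  assumes G: "G \<in> fts s sW" and sW: "vector_space sW" and q: "q \<in> polys s" and \<omega>: "\<omega> \<in> dual s"
  shows "fts_op s sW G (fscale (*) c (monomial (tpow s v n)) + q) \<omega> =
    sW c (\<Sum>k\<le>n. sW (falling n k * \<omega> v ^ (n - k)) (G k (tpow s v k))) + fts_op s sW G q \<omega>"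
proof -
  interpret W: vector_space sW by fact
  let ?p = "fscale (*) c (monomial (tpow s v n)) + q"
  have p: "?p \<in> polys s"
    by (intro field_fun.subspace_add[OF subspace_polys] field_fun.subspace_scale[OF subspace_polys] monomial_mem[OF tpow_mem] q)
  have Gl: "G k \<in> lin_ops tscale sW (sympow s k) UNIV" for k using G by (simp add: fts_def)
  obtain N0 where N0: "\<And>k. k > N0 \<Longrightarrow> Dop s k q \<omega> = 0"
    using Dop_eventually_0[OF q] \<omega> by blast
  define N where "N = max n N0"
  have "fts_op s sW G ?p \<omega> = sW (?p \<omega>) (G 0 (tensor s [])) + (\<Sum>k=1..N. G k (Dop s k ?p \<omega>))"
    by (rule fts_op_eq[OF G p \<omega>]) (simp add: Dop_combination[OF q \<omega>] N0 falling_eq_0 N_def)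
  also have "(\<Sum>k=1..N. G k (Dop s k ?p \<omega>)) =
      (\<Sum>k=1..N. sW (c * falling n k * \<omega> v ^ (n - k)) (G k (tpow s v k))) + (\<Sum>k=1..N. G k (Dop s k q \<omega>))"
    unfolding sum.distrib[symmetric]
    by (intro sum.cong refl)
      (simp add: Dop_combination[OF q \<omega>] lin_ops_add[OF Gl] lin_ops_scale[OF Gl] tpow_mem Dop_mem[OF q \<omega>]
        field_fun.subspace_scale[OF subspace_sympow])
  also have "(\<Sum>k=1..N. sW (c * falling n k * \<omega> v ^ (n - k)) (G k (tpow s v k))) =
      (\<Sum>k=1..n. sW (c * falling n k * \<omega> v ^ (n - k)) (G k (tpow s v k)))"
    by (intro sum.mono_neutral_right) (auto simp: N_def falling_eq_0)
  also have "sW (?p \<omega>) (G 0 (tensor s [])) =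
      sW (c * falling n 0 * \<omega> v ^ (n - 0)) (G 0 (tpow s v 0)) + sW (q \<omega>) (G 0 (tensor s []))"
    by (simp add: fscale_def monomial_apply[OF \<omega>] dual_pow_tpow[OF \<omega>] W.scale_left_distrib falling_def tpow_0)
  finally have "fts_op s sW G ?p \<omega> =
      (sW (c * falling n 0 * \<omega> v ^ (n - 0)) (G 0 (tpow s v 0)) +
        (\<Sum>k=1..n. sW (c * falling n k * \<omega> v ^ (n - k)) (G k (tpow s v k)))) +
      (sW (q \<omega>) (G 0 (tensor s [])) + (\<Sum>k=1..N. G k (Dop s k q \<omega>)))"
    by (simp only: add_ac)
  also have "sW (c * falling n 0 * \<omega> v ^ (n - 0)) (G 0 (tpow s v 0)) +
        (\<Sum>k=1..n. sW (c * falling n k * \<omega> v ^ (n - k)) (G k (tpow s v k))) =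
      (\<Sum>k\<le>n. sW (c * falling n k * \<omega> v ^ (n - k)) (G k (tpow s v k)))"
    unfolding atMost_atLeast0 by (subst (2) sum.atLeast_Suc_atMost) simp_all
  also have "\<dots> = sW c (\<Sum>k\<le>n. sW (falling n k * \<omega> v ^ (n - k)) (G k (tpow s v k)))"
    by (simp add: W.scale_sum_right mult.assoc)
  also have "sW (q \<omega>) (G 0 (tensor s [])) + (\<Sum>k=1..N. G k (Dop s k q \<omega>)) = fts_op s sW G q \<omega>"
    by (rule fts_op_eq[OF G q \<omega>, symmetric]) (simp add: N0 N_def)
  finally show ?thesis .
qed

lemma fts_op_0:
  assumes G: "G \<in> fts s sW" and sW: "vector_space sW" and \<omega>: "\<omega> \<in> dual s"
  shows "fts_op s sW G 0 \<omega> = 0"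
proof -
  interpret W: vector_space sW by fact
  show ?thesis
    using fts_op_eq[OF G field_fun.subspace_0[OF subspace_polys] \<omega>, of 0] by (simp add: Dop_0)
qed

section \<open>Power series along a curve\<close>

text \<open>
  The coefficient of \<open>t\<^sup>j\<close> in the \<open>n\<close>th power of the curve \<open>\<Sum>\<^sub>i t\<^sup>i l\<^sub>i\<close>.
\<close>

definition power_coeff :: "(nat \<Rightarrow> 'v) \<Rightarrow> nat \<Rightarrow> nat \<Rightarrow> ('f, 'v) tensor" where
  "power_coeff l n j = (\<Sum>is\<in>compositions n j. tensor s (map l is))"

lemma power_coeff_apply:
  "multilinear s \<phi> \<Longrightarrow> power_coeff l n j \<phi> = (\<Sum>is\<in>compositions n j. \<phi> (map l is))"
  by (simp add: power_coeff_def sum_fun_apply tensor_def)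

text \<open>
  The set of compositions is stable under permutation of the parts, so the sum of the plain tensors
  is already symmetric.
\<close>

lemma power_coeff_eq_sym: "power_coeff l n j = (\<Sum>is\<in>compositions n j. sym_tensor s (map l is))"
proof -
  have "(\<Sum>is\<in>compositions n j. sym_tensor s (map l is)) =
      (\<Sum>is\<in>compositions n j. tscale (1 / fact n) (\<Sum>\<pi> | \<pi> permutes {..<n}. tensor s (permute_list \<pi> (map l is))))"
    by (intro sum.cong) (auto simp: sym_tensor_def compositions_def)
  also have "\<dots> = tscale (1 / fact n)
      (\<Sum>\<pi> | \<pi> permutes {..<n}. \<Sum>is\<in>compositions n j. tensor s (permute_list \<pi> (map l is)))"
    by (subst sum.swap) (simp add: field_fun.scale_sum_right)
  also have "(\<Sum>\<pi> | \<pi> permutes {..<n}. \<Sum>is\<in>compositions n j. tensor s (permute_list \<pi> (map l is))) =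
      (\<Sum>\<pi> | \<pi> permutes {..<n}. power_coeff l n j)"
  proof (intro sum.cong refl)
    fix \<pi> assume "\<pi> \<in> {\<pi>. \<pi> permutes {..<n}}"
    then have \<pi>: "\<pi> permutes {..<n}" by simp
    have inv: "inv \<pi> permutes {..<n}" by (rule permutes_inv[OF \<pi>])
    have id: "permute_list \<sigma> (permute_list \<tau> is) = is"
      if "\<sigma> permutes {..<n}" "\<tau> \<circ> \<sigma> = id" "is \<in> compositions n j" for \<sigma> \<tau> "is"
      using permute_list_compose[of \<sigma> "is" \<tau>] that by (simp add: compositions_def)
    have mem: "permute_list \<sigma> is \<in> compositions n j" if "\<sigma> permutes {..<n}" "is \<in> compositions n j" for \<sigma> "is"
    proof -
      have "mset (permute_list \<sigma> is) = mset is"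
        using that by (intro mset_permute_list) (simp add: compositions_def)
      then have "sum_list (permute_list \<sigma> is) = sum_list is" by (metis sum_mset_sum_list)
      then show ?thesis using that by (simp add: compositions_def)
    qed
    show "(\<Sum>is\<in>compositions n j. tensor s (permute_list \<pi> (map l is))) = power_coeff l n j"
      unfolding power_coeff_def
    proof (rule sum.reindex_bij_witness[of _ "permute_list (inv \<pi>)" "permute_list \<pi>"])
      fix "is" assume "is": "is \<in> compositions n j"
      show "permute_list (inv \<pi>) (permute_list \<pi> is) = is"
        by (rule id[OF inv _ "is"]) (simp add: permutes_inv_o[OF \<pi>])
      show "permute_list \<pi> (permute_list (inv \<pi>) is) = is"
        by (rule id[OF \<pi> _ "is"]) (simp add: permutes_inv_o[OF \<pi>])
      show "tensor s (map l (permute_list \<pi> is)) = tensor s (permute_list \<pi> (map l is))"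
        using \<pi> "is" by (simp add: permute_list_map compositions_def)
    qed (use mem \<pi> inv in auto)
  qed
  also have "tscale (1 / fact n) (\<Sum>\<pi> | \<pi> permutes {..<n}. power_coeff l n j) = power_coeff l n j"
    by (rule ext, simp only: fscale_def sum_fun_apply) (simp add: card_permutations)
  finally show ?thesis ..
qed

lemma power_coeff_mem: "power_coeff l n j \<in> sympow s n"
  unfolding power_coeff_eq_sym
  by (intro field_fun.subspace_sum[OF subspace_sympow] sym_tensor_mem) (simp add: compositions_def)

lemma lin_ops_power_coeff:
  assumes "T \<in> lin_ops tscale sW (sympow s n) UNIV"
  shows "T (power_coeff l n j) = (\<Sum>is\<in>compositions n j. T (sym_tensor s (map l is)) :: 'b::ab_group_add)"
  unfolding power_coeff_eq_sym
  by (intro lin_ops_sum[OF assms field_fun.vector_space_axioms subspace_sympow] sym_tensor_mem)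
    (simp add: compositions_def)

lemma sym_tensor_zero:
  assumes "0 \<in> set vs"
  shows "sym_tensor s vs = 0"
proof -
  obtain xs ys where "vs = xs @ 0 # ys"
    using split_list[OF assms] by blast
  then show ?thesis
    using sym_tensor_scale[of xs 0 0 ys] by (simp only: scale_zero_left field_fun.scale_zero_left)
qed

lemma power_coeff_eq_positive:
  assumes "l 0 = 0"
  shows "power_coeff l n j =
    (\<Sum>is | length is = n \<and> (\<forall>i\<in>set is. 1 \<le> i) \<and> sum_list is = j. sym_tensor s (map l is))"
  unfolding power_coeff_eq_sym
proof (rule sum.mono_neutral_right[OF finite_compositions])
  show "\<forall>is\<in>compositions n j - {is. length is = n \<and> (\<forall>i\<in>set is. 1 \<le> i) \<and> sum_list is = j}.
      sym_tensor s (map l is) = 0"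
  proof
    fix "is" assume "is \<in> compositions n j - {is. length is = n \<and> (\<forall>i\<in>set is. 1 \<le> i) \<and> sum_list is = j}"
    then have "0 \<in> set is" by (auto simp: compositions_def Suc_le_eq)
    then have "0 \<in> set (map l is)" using assms by force
    then show "sym_tensor s (map l is) = 0" by (rule sym_tensor_zero)
  qed
qed (auto simp: compositions_def)

text \<open>
  For \<open>l\<^sub>0 = 0\<close> the \<open>n\<close>th power of the curve is divisible by \<open>t\<^sup>n\<close>.
\<close>

lemma power_coeff_eq_0:
  assumes "l 0 = 0" "j < n"
  shows "power_coeff l n j = 0"
proof -
  have "length is \<le> sum_list is" if "\<forall>i\<in>set is. 1 \<le> i" for "is" :: "nat list"
    using that by (induction "is") auto
  then have "{is. length is = n \<and> (\<forall>i\<in>set is. 1 \<le> i) \<and> sum_list is = j} = {}"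
    using assms(2) by (auto simp: not_le[symmetric])
  then show ?thesis by (simp only: power_coeff_eq_positive[where l = l, OF assms(1)] sum.empty)
qed

lemma power_coeff_0: "power_coeff l 0 j = (if j = 0 then tensor s [] else 0)"
proof -
  have "compositions 0 j = (if j = 0 then {[]} else {})"
    by (auto simp: compositions_def)
  then show ?thesis by (simp add: power_coeff_def)
qed

section \<open>Closure properties of formal series\<close>

lemma ftsD: "A \<in> fts s sW \<Longrightarrow> A n \<in> lin_ops tscale sW (sympow s n) UNIV"
  by (simp add: fts_def)

lemma fts_0: "A \<in> fts s sW \<Longrightarrow> A n 0 = (0::'b::ab_group_add)"
  by (intro lin_ops_zero[OF ftsD field_fun.vector_space_axioms subspace_sympow])

lemma lin_ops_sum_ops:
  assumes sW: "vector_space sW" and T: "\<And>k. k \<in> K \<Longrightarrow> T k \<in> lin_ops sU sW U UNIV"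
  shows "(\<lambda>f. \<Sum>k\<in>K. T k f :: 'b::ab_group_add) \<in> lin_ops sU sW U UNIV"
proof -
  interpret W: vector_space sW by fact
  show ?thesis
    by (rule lin_opsI)
      (simp_all add: sum.distrib[symmetric] W.scale_sum_right lin_ops_add[OF T] lin_ops_scale[OF T])
qed

lemma fts_mult_mem:
  assumes A: "A \<in> fts s (*)" and C: "C \<in> fts s (*)"
  shows "fts_mult s A C \<in> fts s (*)"
  unfolding fts_def mem_Collect_eq fts_mult_def
proof (intro allI lin_ops_sum_ops vector_space_field)
  fix n k :: nat assume "k \<in> {..n}"
  then show "sym_op s (*) n (\<lambda>v. A k (tpow s v k) * C (n - k) (tpow s v (n - k))) \<in> lin_ops tscale (*) (sympow s n) UNIV"
    using sym_op_product(1)[OF ftsD[OF A] ftsD[OF C], of k "n - k"] by simp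
qed

lemma fts_mult_tpow:
  assumes A: "A \<in> fts s (*)" and C: "C \<in> fts s (*)"
  shows "fts_mult s A C n (tpow s v n) = (\<Sum>k\<le>n. A k (tpow s v k) * C (n - k) (tpow s v (n - k)))"
  unfolding fts_mult_def
proof (intro sum.cong refl)
  fix k assume "k \<in> {..n}"
  then show "sym_op s (*) n (\<lambda>v. A k (tpow s v k) * C (n - k) (tpow s v (n - k))) (tpow s v n) =
      A k (tpow s v k) * C (n - k) (tpow s v (n - k))"
    using sym_op_product(2)[OF ftsD[OF A] ftsD[OF C], of k "n - k" v] by simp
qed

lemma
  shows fts_one_mem: "fts_one s \<in> fts s (*)"
    and fts_one_unit: "fts_one s n (tpow s v n) = (if n = 0 then 1 else 0)"
proof -
  have "multilinear s (\<lambda>vs. if vs = [] then 1 else 0)"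
    by (rule multilinearI) simp_all
  from tpow_apply[OF this, of _ 0]
  have "tpow s v 0 (\<lambda>vs. if vs = [] then 1 else 0) = 1" for v by simp
  note * = sym_op[OF evaluation_lin this]
  have "(0 :: ('f, 'v) tensor \<Rightarrow> 'f) \<in> lin_ops tscale (*) (sympow s n) UNIV" for n
    by (rule lin_opsI) simp_all
  then show "fts_one s \<in> fts s (*)"
    using *(1) by (auto simp: fts_def fts_one_def)
  show "fts_one s n (tpow s v n) = (if n = 0 then 1 else 0)"
    using *(2) by (simp add: fts_one_def)
qed

lemma fts_power_mem:
  assumes "C \<in> fts s (*)"
  shows "(fts_mult s C ^^ k) (fts_one s) \<in> fts s (*)"
  by (induction k) (simp_all add: fts_one_mem fts_mult_mem assms)

lemma fts_exp_mem:
  assumes "C \<in> fts s (*)"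
  shows "fts_exp s C \<in> fts s (*)"
  unfolding fts_def mem_Collect_eq fts_exp_def
proof (intro allI lin_ops_sum_ops vector_space_field)
  fix n k
  show "(\<lambda>f. 1 / fact k * (fts_mult s C ^^ k) (fts_one s) n f) \<in> lin_ops tscale (*) (sympow s n) UNIV"
    by (rule lin_opsI)
      (simp_all add: lin_ops_add[OF ftsD[OF fts_power_mem[OF assms]]]
        lin_ops_scale[OF ftsD[OF fts_power_mem[OF assms]]] distrib_left)
qed

lemma sym_mult_mem:
  assumes "f \<in> sympow s n"
  shows "sym_mult s f (tensor s [\<zeta>]) \<in> sympow s (n + 1)"
proof (rule sympow_into[OF _ field_fun.vector_space_axioms subspace_sympow _ assms])
  show "(\<lambda>f. sym_mult s f (tensor s [\<zeta>])) \<in> lin_ops tscale tscale (sympow s n) UNIV"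
    by (rule lin_opsI) (simp_all add: sym_mult_def fscale_def fun_eq_iff)
  have "tensor s [\<zeta>] = sym_tensor s [\<zeta>]"
    using sym_tensor_replicate[of s 1 \<zeta>] by (simp add: tpow_def)
  then show "sym_mult s (tpow s v n) (tensor s [\<zeta>]) \<in> sympow s (n + 1)" for v
    by (simp add: sym_tensor_replicate[symmetric] sym_mult_sym_tensor sym_tensor_mem)
qed

lemma sym_mult_tpow: "sym_mult s (tpow s v n) (tensor s [\<zeta>]) = sym_tensor s (\<zeta> # replicate n v)"
proof -
  have "tensor s [\<zeta>] = sym_tensor s [\<zeta>]"
    using sym_tensor_replicate[of s 1 \<zeta>] by (simp add: tpow_def)
  then have "sym_mult s (tpow s v n) (tensor s [\<zeta>]) = sym_tensor s (replicate n v @ [\<zeta>])"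
    by (simp only: sym_tensor_replicate[symmetric] sym_mult_sym_tensor)
  also have "\<dots> = sym_tensor s (\<zeta> # replicate n v)"
    by (rule sym_tensor_cong_mset) simp
  finally show ?thesis .
qed

lemma fts_deriv_mem:
  assumes A: "A \<in> fts s sW" and sW: "vector_space sW"
  shows "fts_deriv s sW A \<zeta> \<in> fts s sW"
  unfolding fts_def mem_Collect_eq
proof (intro allI lin_opsI)
  interpret W: vector_space sW by fact
  fix n f g c assume f: "f \<in> sympow s n"
  have add: "sym_mult s (f + g) t = sym_mult s f t + sym_mult s g t" for g and t :: "('f, 'v) tensor"
    by (simp add: sym_mult_def fun_eq_iff)
  have scale: "sym_mult s (tscale c f) t = tscale c (sym_mult s f t)" for t :: "('f, 'v) tensor"
    by (simp add: sym_mult_def fun_eq_iff fscale_def)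
  show "fts_deriv s sW A \<zeta> n (tscale c f) = sW c (fts_deriv s sW A \<zeta> n f)"
    unfolding fts_deriv_def scale lin_ops_scale[OF ftsD[OF A] sym_mult_mem[OF f]]
    by (rule W.scale_left_commute)
  show "fts_deriv s sW A \<zeta> n (f + g) = fts_deriv s sW A \<zeta> n f + fts_deriv s sW A \<zeta> n g"
    if g: "g \<in> sympow s n" for g
    unfolding fts_deriv_def add lin_ops_add[OF ftsD[OF A] sym_mult_mem[OF f] sym_mult_mem[OF g]]
    by (rule W.scale_right_distrib)
qed simp

lemma sym_op_prod_mem:
  assumes "B \<in> fts s s" "f \<in> sympow s (sum_list is)"
  shows "sym_op_prod s B is f \<in> sympow s (length is)"
  by (rule sympow_into[OF sym_op_prod(1)[OF assms(1)] field_fun.vector_space_axioms subspace_sympow _ assms(2)])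
    (simp add: sym_op_prod(2)[OF assms(1)] sym_tensor_mem)

lemma fts_comp_mem:
  assumes A: "A \<in> fts s sW" and sW: "vector_space sW" and L: "L \<in> fts s s"
  shows "fts_comp s A L \<in> fts s sW"
  unfolding fts_def mem_Collect_eq
proof (intro allI)
  fix n
  show "fts_comp s A L n \<in> lin_ops tscale sW (sympow s n) UNIV"
  proof (cases "n = 0")
    case True
    then show ?thesis using ftsD[OF A, of 0] by (simp add: fts_comp_def)
  next
    case False
    let ?K = "\<lambda>m. {is. length is = m \<and> (\<forall>i\<in>set is. 1 \<le> i) \<and> sum_list is = n}"
    let ?T = "\<lambda>m f. \<Sum>is\<in>?K m. sym_op_prod s L is f"
    have T: "?T m \<in> lin_ops tscale tscale (sympow s n) UNIV" for m
      by (intro lin_ops_sum_ops field_fun.vector_space_axioms) (use sym_op_prod(1)[OF L] in auto)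
    have mem: "?T m f \<in> sympow s m" if "f \<in> sympow s n" for m f
      using that by (intro field_fun.subspace_sum[OF subspace_sympow]) (use sym_op_prod_mem[OF L] in auto)
    have "(\<lambda>f. A m (?T m f)) \<in> lin_ops tscale sW (sympow s n) UNIV" for m
    proof (rule lin_opsI)
      fix f g c assume f: "f \<in> sympow s n"
      show "A m (?T m (tscale c f)) = sW c (A m (?T m f))"
        unfolding lin_ops_scale[OF T f] by (rule lin_ops_scale[OF ftsD[OF A] mem[OF f]])
      show "A m (?T m (f + g)) = A m (?T m f) + A m (?T m g)" if g: "g \<in> sympow s n" for g
        unfolding lin_ops_add[OF T f g] by (rule lin_ops_add[OF ftsD[OF A] mem[OF f] mem[OF g]])
    qed simp
    then have "(\<lambda>f. \<Sum>m=1..n. A m (?T m f)) \<in> lin_ops tscale sW (sympow s n) UNIV"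
      by (intro lin_ops_sum_ops sW)
    also have "(\<lambda>f. \<Sum>m=1..n. A m (?T m f)) = fts_comp s A L n"
      using False by (simp add: fts_comp_def fun_eq_iff)
    finally show ?thesis .
  qed
qed

text \<open>
  The coefficient of \<open>t\<^sup>j\<close> in \<open>A(l(t))\<close> for a curve with \<open>l\<^sub>0 = 0\<close>: the powers of \<open>l(t)\<close> with exponent
  greater than \<open>j\<close> do not contribute to it.
\<close>

definition subst_coeff :: "('f, 'v, 'w::ab_group_add) fts \<Rightarrow> (nat \<Rightarrow> 'v) \<Rightarrow> nat \<Rightarrow> 'w" where
  "subst_coeff A l j = (\<Sum>n\<le>j. A n (power_coeff l n j))"

text \<open>
  Composition with \<open>L\<close>, evaluated at \<open>u\<close>, is substitution of the curve \<open>t \<mapsto> L(t u)\<close>. A composition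
  with a part \<open>0\<close> contributes nothing because \<open>L(0) = 0\<close>.
\<close>

lemma fts_comp_tpow:
  assumes A: "A \<in> fts s sW" and L: "L \<in> fts s s" "L 0 (tensor s []) = 0"
  shows "fts_comp s A L j (tpow s u j) = subst_coeff A (\<lambda>i. L i (tpow s u i)) j"
proof (cases "j = 0")
  case True
  then show ?thesis by (simp add: fts_comp_def subst_coeff_def power_coeff_0 tpow_0)
next
  case False
  let ?l = "\<lambda>i. L i (tpow s u i)"
  have l0: "?l 0 = 0" by (simp add: tpow_0 L(2))
  have "fts_comp s A L j (tpow s u j) = (\<Sum>m=1..j. A m (power_coeff ?l m j))"
    using False unfolding fts_comp_def power_coeff_eq_positive[where l = ?l, OF l0]
    by (auto intro!: sum.cong arg_cong[where f = "A _"] simp: sym_op_prod(2)[OF L(1)])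
  also have "\<dots> = (\<Sum>m\<le>j. A m (power_coeff ?l m j))"
    using False fts_0[OF A, of 0] by (intro sum.mono_neutral_left) (auto simp: power_coeff_0 not_le)
  finally show ?thesis by (simp add: subst_coeff_def)
qed

definition subst_fps :: "('f, 'v, 'f) fts \<Rightarrow> (nat \<Rightarrow> 'v) \<Rightarrow> 'f fps" where
  "subst_fps A l = Abs_fps (subst_coeff A l)"

lemma subst_fps_nth [simp]: "subst_fps A l $ j = subst_coeff A l j"
  by (simp add: subst_fps_def)

text \<open>
  The coefficient of \<open>t\<^sup>j\<close> in \<open>(A \<odot> C) l(t)\<^bsup>\<otimes>n\<^esup>\<close>: the product form separates the first \<open>k\<close> factors \<open>l(t)\<close>
  from the others.
\<close>

lemma fts_mult_power_coeff:
  assumes A: "A \<in> fts s (*)" and C: "C \<in> fts s (*)"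
  shows "fts_mult s A C n (power_coeff l n j) =
    (\<Sum>k\<le>n. \<Sum>i\<le>j. A k (power_coeff l k i) * C (n - k) (power_coeff l (n - k) (j - i)))"
  unfolding fts_mult_def
proof (intro sum.cong refl)
  fix k assume k: "k \<in> {..n}"
  have "sym_op s (*) n (\<lambda>v. A k (tpow s v k) * C (n - k) (tpow s v (n - k))) (power_coeff l n j) =
      power_coeff l n j (product_form k (n - k) (A k) (C (n - k)))"
    using sym_op_product(3)[OF ftsD[OF A] ftsD[OF C], of "power_coeff l n j" k "n - k"] k power_coeff_mem
    by simp
  also have "\<dots> = (\<Sum>is\<in>compositions n j. product_form k (n - k) (A k) (C (n - k)) (map l is))"
    by (intro power_coeff_apply product_form_multilinear ftsD A C)
  also have "\<dots> = (\<Sum>is\<in>compositions (k + (n - k)) j.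
      A k (sym_tensor s (map l (take k is))) * C (n - k) (sym_tensor s (map l (drop k is))))"
    using k by (intro sum.cong) (auto simp: product_form_def compositions_def take_map drop_map)
  also have "\<dots> = (\<Sum>i\<le>j. \<Sum>is\<in>compositions k i. \<Sum>js\<in>compositions (n - k) (j - i).
      A k (sym_tensor s (map l is)) * C (n - k) (sym_tensor s (map l js)))"
    by (rule sum_compositions_split)
  also have "\<dots> = (\<Sum>i\<le>j. A k (power_coeff l k i) * C (n - k) (power_coeff l (n - k) (j - i)))"
    by (simp only: lin_ops_power_coeff[OF ftsD[OF A]] lin_ops_power_coeff[OF ftsD[OF C]] sum_product)
  finally show "sym_op s (*) n (\<lambda>v. A k (tpow s v k) * C (n - k) (tpow s v (n - k))) (power_coeff l n j) =
    (\<Sum>i\<le>j. A k (power_coeff l k i) * C (n - k) (power_coeff l (n - k) (j - i)))" .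
qed

text \<open>
  For fixed \<open>i\<close>, the sum over the degrees \<open>k\<close> and \<open>n - k\<close> is the product of two polynomials of degrees
  at most \<open>i\<close> and \<open>j - i\<close>, evaluated at \<open>1\<close>.
\<close>

lemma subst_fps_mult:
  assumes A: "A \<in> fts s (*)" and C: "C \<in> fts s (*)" and l: "l 0 = 0"
  shows "subst_fps (fts_mult s A C) l = subst_fps A l * subst_fps C l"
proof (rule fps_ext)
  fix j
  have "subst_coeff (fts_mult s A C) l j =
      (\<Sum>n\<le>j. \<Sum>k\<le>n. \<Sum>i\<le>j. A k (power_coeff l k i) * C (n - k) (power_coeff l (n - k) (j - i)))"
    by (simp only: subst_coeff_def fts_mult_power_coeff[OF A C])
  also have "\<dots> = (\<Sum>n\<le>j. \<Sum>i\<le>j. \<Sum>k\<le>n. A k (power_coeff l k i) * C (n - k) (power_coeff l (n - k) (j - i)))"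
    by (intro sum.cong refl sum.swap)
  also have "\<dots> = (\<Sum>i\<le>j. \<Sum>n\<le>j. \<Sum>k\<le>n. A k (power_coeff l k i) * C (n - k) (power_coeff l (n - k) (j - i)))"
    by (rule sum.swap)
  also have "\<dots> = (\<Sum>i\<le>j. subst_coeff A l i * subst_coeff C l (j - i))"
  proof (intro sum.cong refl)
    fix i assume "i \<in> {..j}"
    then show "(\<Sum>n\<le>j. \<Sum>k\<le>n. A k (power_coeff l k i) * C (n - k) (power_coeff l (n - k) (j - i))) =
        subst_coeff A l i * subst_coeff C l (j - i)"
      using polynomial_product[of i "\<lambda>k. A k (power_coeff l k i)" "j - i" "\<lambda>k. C k (power_coeff l k (j - i))" 1]
      by (simp add: subst_coeff_def power_coeff_eq_0[where l = l, OF l] fts_0[OF A] fts_0[OF C])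
  qed
  finally show "subst_fps (fts_mult s A C) l $ j = (subst_fps A l * subst_fps C l) $ j"
    by (simp add: fps_mult_nth atMost_atLeast0)
qed

lemma subst_fps_one: "subst_fps (fts_one s) l = 1"
proof (rule fps_ext)
  fix j
  have "subst_coeff (fts_one s) l j = (\<Sum>n\<le>j. if n = 0 then (if j = 0 then 1 else 0) else 0)"
    unfolding subst_coeff_def
    using fts_one_unit[of 0] fts_0[OF fts_one_mem, of 0]
    by (intro sum.cong) (auto simp: power_coeff_0 tpow_0 fts_one_def)
  then show "subst_fps (fts_one s) l $ j = 1 $ j" by simp
qed

text \<open>
  The power series \<open>A(t v)\<close> in \<open>t\<close>.
\<close>

definition value_fps :: "('f, 'v, 'f) fts \<Rightarrow> 'v \<Rightarrow> 'f fps" where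
  "value_fps A v = Abs_fps (\<lambda>n. A n (tpow s v n))"

lemma value_fps_nth [simp]: "value_fps A v $ n = A n (tpow s v n)"
  by (simp add: value_fps_def)

lemma value_fps_mult:
  assumes "A \<in> fts s (*)" "C \<in> fts s (*)"
  shows "value_fps (fts_mult s A C) v = value_fps A v * value_fps C v"
  by (rule fps_ext) (simp add: fts_mult_tpow[OF assms] fps_mult_nth atMost_atLeast0)

lemma value_fps_power:
  assumes "C \<in> fts s (*)"
  shows "value_fps ((fts_mult s C ^^ k) (fts_one s)) v = value_fps C v ^ k"
proof (induction k)
  case 0
  show ?case by (rule fps_ext) (simp add: fts_one_unit)
qed (simp add: value_fps_mult fts_power_mem assms)

lemma fts_exp_tpow:
  assumes "C \<in> fts s (*)"
  shows "fts_exp s C n (tpow s v n) = (\<Sum>k\<le>n. 1 / fact k * (value_fps C v ^ k) $ n)"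
  unfolding fts_exp_def value_fps_power[OF assms, symmetric] by simp

text \<open>
  The \<open>k\<close>th power of a series without constant term starts in degree \<open>k\<close>, so truncating the
  exponential series at the degree of the coefficient is harmless.
\<close>

lemma fts_power_eq_0:
  assumes C: "C \<in> fts s (*)" "C 0 (tensor s []) = 0" and f: "f \<in> sympow s n" and "n < k"
  shows "(fts_mult s C ^^ k) (fts_one s) n f = 0"
proof -
  have "(fts_mult s C ^^ k) (fts_one s) n (tpow s v n) = 0" for v
  proof -
    have "(value_fps C v ^ k) $ n = 0"
      using startsby_zero_power_prefix[of "value_fps C v" k] C(2) \<open>n < k\<close> by (simp add: tpow_0)
    then show ?thesis
      unfolding value_fps_power[OF C(1), symmetric] by simp
  qed
  then show ?thesis
    by (intro sympow_cong[where T' = "\<lambda>_. 0" and n = n and sW = "(*)", OF ftsD[OF fts_power_mem[OF C(1)]] _ _ f])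
      (simp_all add: lin_ops_def)
qed

lemma subst_fps_exp:
  assumes C: "C \<in> fts s (*)" "C 0 (tensor s []) = 0" and l: "l 0 = 0"
  shows "subst_fps (fts_exp s C) l = fps_exp 1 oo subst_fps C l"
proof (rule fps_ext)
  fix j
  let ?P = "\<lambda>k. (fts_mult s C ^^ k) (fts_one s)"
  have power: "subst_fps (?P k) l = subst_fps C l ^ k" for k
    by (induction k) (simp_all add: subst_fps_one subst_fps_mult C(1) fts_power_mem l)
  have "subst_coeff (fts_exp s C) l j = (\<Sum>n\<le>j. \<Sum>k\<le>n. 1 / fact k * ?P k n (power_coeff l n j))"
    by (simp add: subst_coeff_def fts_exp_def)
  also have "\<dots> = (\<Sum>n\<le>j. \<Sum>k\<le>j. 1 / fact k * ?P k n (power_coeff l n j))"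
    by (intro sum.cong refl sum.mono_neutral_left) (auto simp: fts_power_eq_0[OF C power_coeff_mem])
  also have "\<dots> = (\<Sum>k\<le>j. 1 / fact k * subst_fps (?P k) l $ j)"
    by (subst sum.swap) (simp add: subst_coeff_def sum_distrib_left)
  finally show "subst_fps (fts_exp s C) l $ j = (fps_exp 1 oo subst_fps C l) $ j"
    unfolding power by (simp add: fps_compose_nth atMost_atLeast0)
qed

end

section \<open>The exponential of a sum of power series\<close>

lemma fps_linear_ode_zero:
  fixes y :: "'a::field_char_0 fps"
  assumes "fps_deriv y = c * y" "y $ 0 = 0"
  shows "y = 0"
proof (rule fps_ext)
  fix n
  show "y $ n = 0 $ n"
  proof (induction n rule: less_induct)
    case (less n)
    show ?case
    proof (cases n)
      case (Suc m)
      have "of_nat n * y $ n = fps_deriv y $ m"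
        by (simp add: Suc)
      also have "\<dots> = (\<Sum>i=0..m. c $ i * y $ (m - i))"
        by (simp add: assms(1) fps_mult_nth)
      also have "\<dots> = 0"
        using less by (intro sum.neutral) (simp add: Suc)
      finally show ?thesis using Suc by (simp del: of_nat_Suc)
    qed (simp add: assms(2))
  qed
qed

text \<open>
  Both sides solve the linear equation \<open>y' = (f + g)' y\<close> with \<open>y(0) = 1\<close>.
\<close>

lemma fps_exp_compose_add:
  fixes f g :: "'a::field_char_0 fps"
  assumes "f $ 0 = 0" "g $ 0 = 0"
  shows "fps_exp 1 oo (f + g) = (fps_exp 1 oo f) * (fps_exp 1 oo g)"
proof -
  have deriv: "fps_deriv (fps_exp 1 oo h) = (fps_exp 1 oo h) * fps_deriv h" if "h $ 0 = 0" for h :: "'a fps"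
    using fps_compose_deriv[OF that, of "fps_exp 1"] by simp
  define y where "y = (fps_exp 1 oo (f + g)) - (fps_exp 1 oo f) * (fps_exp 1 oo g)"
  have "fps_deriv y = fps_deriv (f + g) * y"
    using assms by (simp add: y_def deriv algebra_simps)
  moreover have "y $ 0 = 0" by (simp add: y_def)
  ultimately have "y = 0" by (rule fps_linear_ode_zero)
  then show ?thesis by (simp add: y_def)
qed

lemma fps_exp_compose_X: "fps_exp 1 oo (fps_const c * fps_X) = fps_exp (c::'a::field_char_0)"
  by (rule fps_ext) (simp add: fps_compose_nth power_mult_distrib fps_const_power[symmetric]
    fps_X_power_iff if_distrib sum.delta cong: if_cong)

section \<open>Directional derivatives\<close>

text \<open>
  The assumption covers the case in which \<open>x 1\<close> is not among the coefficients.
\<close>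

lemma polynomial_derivative_at_0:
  fixes x :: "nat \<Rightarrow> 'f::real_normed_field"
  assumes "n = 0 \<Longrightarrow> x 1 = 0"
  shows "((\<lambda>t. \<Sum>j\<le>n. t ^ j * x j) has_field_derivative x 1) (at 0)"
proof -
  have "((\<lambda>t. \<Sum>j\<le>n. t ^ j * x j) has_field_derivative (\<Sum>j\<le>n. of_nat j * 0 ^ (j - 1) * x j)) (at 0)"
    by (auto intro!: derivative_eq_intros)
  also have "(\<Sum>j\<le>n. of_nat j * 0 ^ (j - 1) * x j) = (\<Sum>j\<le>n. if j = 1 then x 1 else 0)"
    by (intro sum.cong refl) (auto simp: power_0_left)
  also have "\<dots> = x 1"
    using assms by (simp add: sum.delta')
  finally show ?thesis .
qed

lemma fps_power_derivative:
  fixes c :: "'f::real_normed_field \<Rightarrow> 'f fps"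
  assumes "\<And>n. ((\<lambda>t. c t $ n) has_field_derivative c' $ n) (at a)"
  shows "((\<lambda>t. (c t ^ k) $ n) has_field_derivative (of_nat k * c a ^ (k - 1) * c') $ n) (at a)"
proof (induction k arbitrary: n)
  case (Suc k)
  have "((\<lambda>t. (c t ^ Suc k) $ n) has_field_derivative
      (\<Sum>i=0..n. c' $ i * (c a ^ k) $ (n - i) + (of_nat k * c a ^ (k - 1) * c') $ (n - i) * c a $ i)) (at a)"
    unfolding power_Suc fps_mult_nth[of "c _"]
    by (intro DERIV_sum DERIV_mult assms Suc)
  also have "(\<Sum>i=0..n. c' $ i * (c a ^ k) $ (n - i) + (of_nat k * c a ^ (k - 1) * c') $ (n - i) * c a $ i) =
      (c' * c a ^ k + c a * (of_nat k * c a ^ (k - 1) * c')) $ n"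
    by (simp add: fps_mult_nth[of c'] fps_mult_nth[of "c a"] sum.distrib mult.commute)
  also have "c' * c a ^ k + c a * (of_nat k * c a ^ (k - 1) * c') = of_nat (Suc k) * c a ^ (Suc k - 1) * c'"
    by (cases k) (simp_all add: algebra_simps)
  finally show ?case .
qed simp

context
  fixes s :: "'f::real_normed_field \<Rightarrow> 'v::ab_group_add \<Rightarrow> 'v"
  assumes s: "vector_space s"
begin

interpretation scalar_space s
  using s by (simp add: scalar_space_def)

text \<open>
  The derivative series has its degree lowered by one, which the factor \<open>X\<close> undoes. The formal
  derivative is related to an actual one, in the scalar variable \<open>t\<close>, so that the product rule
  becomes available.
\<close>

lemma tpow_derivative:
  assumes A: "A \<in> fts s (*)"
  shows "((\<lambda>t. A n (tpow s (v + s t \<zeta>) n)) has_field_derivative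
    (fps_X * value_fps (fts_deriv s (*) A \<zeta>) v) $ n) (at 0)"
proof -
  define M where "M vs = (if length vs = n then A n (sym_tensor s vs) else 0)" for vs
  have "symmetric_multilinear s (*) M"
  proof (intro symmetric_multilinear.intro s vector_space_field symmetric_multilinear_axioms.intro)
    show "M xs = M ys" if "mset xs = mset ys" for xs ys
      using sym_tensor_cong_mset[OF that, of s] mset_eq_length[OF that] by (simp add: M_def)
    show "M ((u + v) # ys) = M (u # ys) + M (v # ys)" for u v ys
      using lin_ops_sym_tensor(1)[OF ftsD[OF A], of "[]" ys n] by (simp add: M_def)
    show "M (s c v # ys) = c * M (v # ys)" for c v ys
      using lin_ops_sym_tensor(2)[OF ftsD[OF A], of "[]" ys n] by (simp add: M_def)
  qed
  from symmetric_multilinear.expand[OF this, of "[]" n v \<zeta>] obtain x where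
    x: "\<And>t. M (replicate n (v + s t \<zeta>)) = (\<Sum>j\<le>n. t ^ j * x j)" "x 1 = of_nat n * M (\<zeta> # replicate (n - 1) v)"
    by auto
  have "(\<lambda>t. A n (tpow s (v + s t \<zeta>) n)) = (\<lambda>t. \<Sum>j\<le>n. t ^ j * x j)"
    by (simp add: x(1)[symmetric] M_def sym_tensor_replicate)
  moreover have "(fps_X * value_fps (fts_deriv s (*) A \<zeta>) v) $ n = x 1"
    using x(2) by (cases n) (simp_all add: M_def fts_deriv_def sym_mult_tpow)
  ultimately show ?thesis
    using polynomial_derivative_at_0[of n x] x(2) by simp
qed

text \<open>
  Both sides are, up to the degree shift, the derivative at \<open>t = 0\<close> of the coefficient of
  \<open>exp[C(v + t \<zeta>)]\<close>: on the left as the value of an operator at \<open>(v + t \<zeta>)\<^bsup>\<otimes>(n+1)\<^esup>\<close>, on the right by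
  differentiating the powers of \<open>C\<close> one by one.
\<close>

lemma fts_exp_deriv_tpow:
  assumes C: "C \<in> fts s (*)" "C 0 (tensor s []) = 0"
  shows "fts_deriv s (*) (fts_exp s C) \<zeta> n (tpow s v n) =
    fts_mult s (fts_exp s C) (fts_deriv s (*) C \<zeta>) n (tpow s v n)"
proof -
  let ?c = "value_fps C v" and ?d = "value_fps (fts_deriv s (*) C \<zeta>) v"
  have c0: "?c $ 0 = 0" using C(2) by (simp add: tpow_0)
  have d: "fts_deriv s (*) C \<zeta> \<in> fts s (*)"
    by (intro fts_deriv_mem C vector_space_field)
  have e: "fts_exp s C n (tpow s v n) = (fps_exp 1 oo ?c) $ n" for n
    by (simp add: fts_exp_tpow[OF C(1)] fps_compose_nth atMost_atLeast0)
  have "((\<lambda>t. value_fps C (v + s t \<zeta>) $ n) has_field_derivative (fps_X * ?d) $ n) (at 0)" for n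
    using tpow_derivative[OF C(1)] by simp
  from fps_power_derivative[OF this]
  have power: "((\<lambda>t. (value_fps C (v + s t \<zeta>) ^ k) $ n) has_field_derivative
      (of_nat k * ?c ^ (k - 1) * (fps_X * ?d)) $ n) (at 0)" for k n
    by simp
  have "((\<lambda>t. fts_exp s C (Suc n) (tpow s (v + s t \<zeta>) (Suc n))) has_field_derivative
      (\<Sum>k\<le>Suc n. 1 / fact k * (of_nat k * ?c ^ (k - 1) * (fps_X * ?d)) $ Suc n)) (at 0)"
    unfolding fts_exp_tpow[OF C(1)] by (intro DERIV_sum DERIV_cmult power)
  from DERIV_unique[OF tpow_derivative[OF fts_exp_mem[OF C(1)]] this]
  have "fts_deriv s (*) (fts_exp s C) \<zeta> n (tpow s v n) =
      (\<Sum>k\<le>Suc n. 1 / fact k * (of_nat k * ?c ^ (k - 1) * (fps_X * ?d)) $ Suc n)"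
    by simp
  also have "\<dots> = (\<Sum>k\<le>n. 1 / fact k * (?c ^ k * ?d) $ n)"
  proof -
    have "1 / fact (Suc k) * (of_nat (Suc k) * ?c ^ (Suc k - 1) * (fps_X * ?d)) $ Suc n =
        1 / fact k * (?c ^ k * ?d) $ n" for k
    proof -
      have "of_nat (Suc k) * ?c ^ (Suc k - 1) * (fps_X * ?d) = fps_X * (fps_const (of_nat (Suc k)) * (?c ^ k * ?d))"
        by (simp only: fps_of_nat diff_Suc_1 mult_ac)
      then have "(of_nat (Suc k) * ?c ^ (Suc k - 1) * (fps_X * ?d)) $ Suc n = of_nat (Suc k) * (?c ^ k * ?d) $ n"
        by (simp only: fps_X_mult_nth fps_mult_left_const_nth) simp
      then show ?thesis
        by (simp only: fact_Suc) (simp del: of_nat_Suc)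
    qed
    then show ?thesis by (subst sum.atMost_Suc_shift) simp
  qed
  also have "\<dots> = (\<Sum>k\<le>n. \<Sum>i=0..n. 1 / fact k * (?c ^ k $ i * ?d $ (n - i)))"
    by (simp add: fps_mult_nth sum_distrib_left)
  also have "\<dots> = (\<Sum>i=0..n. \<Sum>k\<le>n. 1 / fact k * (?c ^ k $ i * ?d $ (n - i)))"
    by (rule sum.swap)
  also have "\<dots> = (\<Sum>i=0..n. (fps_exp 1 oo ?c) $ i * ?d $ (n - i))"
  proof (intro sum.cong refl)
    fix i assume "i \<in> {0..n}"
    then have "(\<Sum>k\<le>n. 1 / fact k * (?c ^ k $ i * ?d $ (n - i))) = (\<Sum>k\<in>{0..i}. 1 / fact k * (?c ^ k $ i * ?d $ (n - i)))"
      using startsby_zero_power_prefix[OF c0] by (intro sum.mono_neutral_right) auto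
    then show "(\<Sum>k\<le>n. 1 / fact k * (?c ^ k $ i * ?d $ (n - i))) = (fps_exp 1 oo ?c) $ i * ?d $ (n - i)"
      by (simp add: fps_compose_nth sum_distrib_right mult.assoc)
  qed
  also have "\<dots> = fts_mult s (fts_exp s C) (fts_deriv s (*) C \<zeta>) n (tpow s v n)"
    by (simp add: fts_mult_tpow[OF fts_exp_mem[OF C(1)] d] e atMost_atLeast0)
  finally show ?thesis .
qed

lemma fts_exp_deriv:
  assumes C: "C \<in> fts s (*)" "C 0 (tensor s []) = 0" and f: "f \<in> sympow s n"
  shows "fts_deriv s (*) (fts_exp s C) \<zeta> n f = fts_mult s (fts_exp s C) (fts_deriv s (*) C \<zeta>) n f"
proof (rule sympow_cong[where n = n and sW = "(*)", OF _ _ _ f])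
  show "fts_deriv s (*) (fts_exp s C) \<zeta> n \<in> lin_ops tscale (*) (sympow s n) UNIV"
    by (intro ftsD fts_deriv_mem fts_exp_mem C vector_space_field)
  show "fts_mult s (fts_exp s C) (fts_deriv s (*) C \<zeta>) n \<in> lin_ops tscale (*) (sympow s n) UNIV"
    by (intro ftsD fts_mult_mem fts_deriv_mem fts_exp_mem C vector_space_field)
qed (rule fts_exp_deriv_tpow[OF C])

section \<open>Raising operators\<close>

lemma sheffer_polynomial_mem:
  assumes "polynomial_sequence s S" "f \<in> sympow s n"
  shows "on_dual s (\<lambda>\<omega>. S n \<omega> f) \<in> polys s"
proof -
  obtain T where T: "\<And>k. k \<le> n \<Longrightarrow> T k n \<in> lin_ops tscale tscale (sympow s n) (sympow s k)"
    "\<And>\<omega> f. \<omega> \<in> dual s \<Longrightarrow> f \<in> sympow s n \<Longrightarrow> S n \<omega> f = (\<Sum>k\<le>n. dual_pow \<omega> (T k n f))"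
    using assms(1) unfolding polynomial_sequence_def by blast
  have "on_dual s (\<lambda>\<omega>. S n \<omega> f) = on_dual s (\<lambda>\<omega>. \<Sum>k\<le>n. dual_pow \<omega> (T k n f))"
    using T(2) assms(2) by (auto simp: on_dual_def fun_eq_iff)
  also have "\<dots> \<in> polys s"
    using lin_ops_mem[OF T(1) assms(2)]
    unfolding polys_def by (intro CollectI exI[of _ n] exI[of _ "\<lambda>k. T k n f"]) auto
  finally show ?thesis .
qed

text \<open>
  The coefficient of degree \<open>j\<close> in \<open>R(\<zeta>) e\<^bsup>\<langle>\<omega>, u\<rangle>\<^esup> = e\<^bsup>\<langle>\<omega>, u\<rangle>\<^esup> (\<langle>\<omega>, \<Phi>\<^sub>\<zeta>(u)\<rangle> + \<Gamma>\<^sub>\<zeta>(u))\<close>, multiplied by \<open>j!\<close>.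
\<close>

lemma raising_operator_on_powers:
  assumes S: "polynomial_sequence s S"
    and B: "B \<in> fts1 s" and \<alpha>: "\<alpha> \<in> fts s (*)" "\<alpha> 0 (tensor s []) = 0"
    and gen: "\<And>\<omega>. \<omega> \<in> dual s \<Longrightarrow> fts_eq s (gen_fun S \<omega>) (fts_exp s (\<lambda>n f. \<omega> (B n f) + \<alpha> n f))"
    and L: "fts_inverse s B L" and R: "raising_operator s S \<zeta> R" and \<omega>: "\<omega> \<in> dual s"
  defines "\<Phi> \<equiv> fts_comp s (fts_deriv s s B \<zeta>) L" and "\<Gamma> \<equiv> fts_comp s (fts_deriv s (*) \<alpha> \<zeta>) L"
  shows "R (monomial (tpow s u j)) \<omega> =
    (\<Sum>k\<le>j. falling j k * \<omega> u ^ (j - k) * (\<omega> (\<Phi> k (tpow s u k)) + \<Gamma> k (tpow s u k)))"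
proof -
  define l where "l = (\<lambda>i. L i (tpow s u i))"
  define C where "C = (\<lambda>\<omega> n f. \<omega> (B n f) + \<alpha> n f)"
  have Bf: "B \<in> fts s s" "B 0 (tensor s []) = 0" using B by (auto simp: fts1_def)
  have Lf: "L \<in> fts s s" "L 0 (tensor s []) = 0" using L by (auto simp: fts1_def fts_inverse_def)
  have l0: "l 0 = 0" by (simp add: l_def tpow_0 Lf)
  have C: "C \<omega> \<in> fts s (*)" "C \<omega> 0 (tensor s []) = 0" if "\<omega> \<in> dual s" for \<omega>
  proof -
    show "C \<omega> \<in> fts s (*)"
      unfolding fts_def mem_Collect_eq C_def
      by (intro allI lin_opsI)
        (simp_all add: lin_ops_add[OF ftsD[OF Bf(1)]] lin_ops_scale[OF ftsD[OF Bf(1)]] lin_ops_add[OF ftsD[OF \<alpha>(1)]]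
          lin_ops_scale[OF ftsD[OF \<alpha>(1)]] dual_add[OF that] dual_scale[OF that] distrib_left)
    show "C \<omega> 0 (tensor s []) = 0"
      using that by (simp add: C_def Bf \<alpha> dual_zero)
  qed
  define a where "a = subst_fps \<alpha> l"
  define E where "E = fps_exp 1 oo a"
  have a0: "a $ 0 = 0"
    by (simp add: a_def subst_coeff_def power_coeff_0 \<alpha>)
  have E0: "E $ 0 \<noteq> 0"
    by (simp add: E_def)
  have BL: "subst_coeff B l i = (if i = 1 then u else 0)" for i
  proof -
    have "subst_coeff B l i = fts_comp s B L i (tpow s u i)"
      unfolding l_def by (rule fts_comp_tpow[OF Bf(1) Lf, symmetric])
    also have "\<dots> = fts_id s i (tpow s u i)"
      using L tpow_mem by (simp add: fts_inverse_def fts_eq_def)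
    finally show ?thesis
      using sym_op_identity[of u] by (simp add: fts_id_def)
  qed
  \<comment> \<open>As \<open>B(L(t u)) = t u\<close>, the generating function becomes \<open>e\<^bsup>t \<langle>\<omega>, u\<rangle>\<^esup> E(t)\<close>.\<close>
  have F: "subst_fps (fts_exp s (C \<omega>)) l = fps_exp (\<omega> u) * E" if "\<omega> \<in> dual s" for \<omega>
  proof -
    have "subst_fps (C \<omega>) l = fps_const (\<omega> u) * fps_X + a"
    proof (rule fps_ext)
      fix i
      have "subst_coeff (C \<omega>) l i = \<omega> (subst_coeff B l i) + subst_coeff \<alpha> l i"
        by (simp add: subst_coeff_def C_def sum.distrib dual_sum[OF that])
      also have "\<omega> (subst_coeff B l i) = (fps_const (\<omega> u) * fps_X) $ i"
        unfolding BL by (simp add: dual_zero[OF that])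
      finally show "subst_fps (C \<omega>) l $ i = (fps_const (\<omega> u) * fps_X + a) $ i"
        by (simp add: a_def)
    qed
    then have "subst_fps (fts_exp s (C \<omega>)) l = fps_exp 1 oo (fps_const (\<omega> u) * fps_X + a)"
      by (simp only: subst_fps_exp[where l = l, OF C[OF that] l0])
    also have "\<dots> = fps_exp (\<omega> u) * E"
      unfolding E_def by (subst fps_exp_compose_add) (simp_all add: a0 fps_exp_compose_X)
    finally show ?thesis .
  qed
  \<comment> \<open>The coefficients of \<open>F\<^sub>\<omega>(L(t u))\<close>, as polynomials in \<open>\<omega>\<close>: here the action of \<open>R\<close> is known.\<close>
  define q where "q i = (\<Sum>n\<le>i. fscale (*) (1 / fact n) (on_dual s (\<lambda>\<omega>. S n \<omega> (power_coeff l n i))))" for i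
  have Sp: "on_dual s (\<lambda>\<omega>. S n \<omega> (power_coeff l n i)) \<in> polys s" for n i
    by (rule sheffer_polynomial_mem[OF S power_coeff_mem])
  have qp: "q i \<in> polys s" for i
    unfolding q_def
    by (intro field_fun.subspace_sum[OF subspace_polys] field_fun.subspace_scale[OF subspace_polys] Sp)
  have G: "1 / fact n * S n \<omega> f = fts_exp s (C \<omega>) n f" if "\<omega> \<in> dual s" "f \<in> sympow s n" for \<omega> n f
    using gen[OF that(1)] that(2) by (simp add: fts_eq_def gen_fun_def C_def)
  have q: "q i \<omega> = (fps_exp (\<omega> u) * E) $ i" if "\<omega> \<in> dual s" for \<omega> i
  proof -
    have "q i \<omega> = (\<Sum>n\<le>i. 1 / fact n * S n \<omega> (power_coeff l n i))"
      using that by (simp add: q_def sum_fun_apply fscale_def on_dual_def)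
    also have "\<dots> = subst_coeff (fts_exp s (C \<omega>)) l i"
      unfolding subst_coeff_def using G[OF that power_coeff_mem] by (intro sum.cong) auto
    finally show ?thesis
      unfolding F[OF that, symmetric] by simp
  qed
  have Rl: "R \<in> lin_ops (fscale (*)) (fscale (*)) (polys s) (polys s)"
    and RS: "\<And>n f. f \<in> sympow s n \<Longrightarrow>
      R (on_dual s (\<lambda>\<omega>'. S n \<omega>' f)) \<omega> = S (n + 1) \<omega> (sym_mult s f (tensor s [\<zeta>]))"
    using R \<omega> by (auto simp: raising_operator_def)
  define H where "H = subst_fps (fts_deriv s (*) (C \<omega>) \<zeta>) l"
  \<comment> \<open>Raising is directional differentiation of \<open>F\<^sub>\<omega>\<close>, to which the chain rule applies.\<close>
  have Rq: "R (q i) \<omega> = (fps_exp (\<omega> u) * E * H) $ i" for i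
  proof -
    have "R (q i) = (\<Sum>n\<le>i. R (fscale (*) (1 / fact n) (on_dual s (\<lambda>\<omega>. S n \<omega> (power_coeff l n i)))))"
      unfolding q_def
      by (rule lin_ops_sum[OF Rl field_fun.vector_space_axioms subspace_polys])
        (intro field_fun.subspace_scale[OF subspace_polys] Sp)
    then have "R (q i) \<omega> = (\<Sum>n\<le>i. 1 / fact n * R (on_dual s (\<lambda>\<omega>. S n \<omega> (power_coeff l n i))) \<omega>)"
      by (simp only: sum_fun_apply lin_ops_scale[OF Rl Sp]) (simp only: fscale_def)
    also have "\<dots> = (\<Sum>n\<le>i. fts_deriv s (*) (fts_exp s (C \<omega>)) \<zeta> n (power_coeff l n i))"
    proof (intro sum.cong refl)
      fix n
      show "1 / fact n * R (on_dual s (\<lambda>\<omega>. S n \<omega> (power_coeff l n i))) \<omega> =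
          fts_deriv s (*) (fts_exp s (C \<omega>)) \<zeta> n (power_coeff l n i)"
        unfolding RS[OF power_coeff_mem] fts_deriv_def G[OF \<omega> sym_mult_mem[OF power_coeff_mem], symmetric]
        by (simp add: divide_simps del: of_nat_Suc)
    qed
    also have "\<dots> = subst_fps (fts_mult s (fts_exp s (C \<omega>)) (fts_deriv s (*) (C \<omega>) \<zeta>)) l $ i"
      by (simp add: subst_coeff_def fts_exp_deriv[OF C[OF \<omega>] power_coeff_mem])
    also have "\<dots> = (fps_exp (\<omega> u) * E * H) $ i"
      unfolding H_def F[OF \<omega>, symmetric]
      by (subst subst_fps_mult[where l = l])
        (auto intro!: fts_exp_mem fts_deriv_mem C \<omega> vector_space_field l0)
    finally show ?thesis .
  qed
  have H: "H $ k = \<omega> (\<Phi> k (tpow s u k)) + \<Gamma> k (tpow s u k)" for k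
  proof -
    have "fts_deriv s (*) (C \<omega>) \<zeta> n f = \<omega> (fts_deriv s s B \<zeta> n f) + fts_deriv s (*) \<alpha> \<zeta> n f" for n f
      by (simp add: fts_deriv_def C_def dual_scale[OF \<omega>] distrib_left del: of_nat_Suc)
    then have "H $ k = \<omega> (subst_coeff (fts_deriv s s B \<zeta>) l k) + subst_coeff (fts_deriv s (*) \<alpha> \<zeta>) l k"
      by (simp add: H_def subst_coeff_def sum.distrib dual_sum[OF \<omega>])
    also have "subst_coeff (fts_deriv s s B \<zeta>) l k = \<Phi> k (tpow s u k)"
      unfolding \<Phi>_def l_def by (rule fts_comp_tpow[OF fts_deriv_mem[OF Bf(1) s] Lf, symmetric])
    also have "subst_coeff (fts_deriv s (*) \<alpha> \<zeta>) l k = \<Gamma> k (tpow s u k)"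
      unfolding \<Gamma>_def l_def by (rule fts_comp_tpow[OF fts_deriv_mem[OF \<alpha>(1) vector_space_field] Lf, symmetric])
    finally show ?thesis .
  qed
  \<comment> \<open>Dividing by \<open>E(t)\<close>, which does not involve \<open>\<omega>\<close>, expresses the powers through the \<open>q i\<close>.\<close>
  have mono: "monomial (tpow s u j) = (\<Sum>i\<le>j. fscale (*) (fact j * inverse E $ (j - i)) (q i))"
  proof
    fix \<omega>
    show "monomial (tpow s u j) \<omega> = (\<Sum>i\<le>j. fscale (*) (fact j * inverse E $ (j - i)) (q i)) \<omega>"
    proof (cases "\<omega> \<in> dual s")
      case True
      have "fps_exp (\<omega> u) = fps_exp (\<omega> u) * E * inverse E"
        using inverse_mult_eq_1'[OF E0] by (simp add: mult.assoc)
      from arg_cong[OF this, of "\<lambda>f. fact j * f $ j"]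
      have "\<omega> u ^ j = (\<Sum>i\<le>j. fact j * ((fps_exp (\<omega> u) * E) $ i * inverse E $ (j - i)))"
        by (simp add: fps_mult_nth[of "_ * _" "inverse E"] sum_distrib_left atMost_atLeast0)
      then show ?thesis
        using True by (simp add: monomial_apply dual_pow_tpow sum_fun_apply fscale_def q mult_ac)
    next
      case False
      then show ?thesis
        by (simp add: monomial_outside sum_fun_apply fscale_def q_def on_dual_def)
    qed
  qed
  have "R (monomial (tpow s u j)) = (\<Sum>i\<le>j. R (fscale (*) (fact j * inverse E $ (j - i)) (q i)))"
    unfolding mono
    by (rule lin_ops_sum[OF Rl field_fun.vector_space_axioms subspace_polys])
      (intro field_fun.subspace_scale[OF subspace_polys] qp)
  then have "R (monomial (tpow s u j)) \<omega> = (\<Sum>i\<le>j. fact j * inverse E $ (j - i) * (fps_exp (\<omega> u) * E * H) $ i)"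
    by (simp only: sum_fun_apply lin_ops_scale[OF Rl qp]) (simp only: fscale_def Rq)
  also have "\<dots> = fact j * (fps_exp (\<omega> u) * E * H * inverse E) $ j"
    unfolding fps_mult_nth[of "fps_exp (\<omega> u) * E * H" "inverse E"] sum_distrib_left atMost_atLeast0
    by (intro sum.cong refl) (simp only: mult_ac)
  also have "fps_exp (\<omega> u) * E * H * inverse E = H * fps_exp (\<omega> u) * (E * inverse E)"
    by (simp only: mult_ac)
  also have "\<dots> = H * fps_exp (\<omega> u)"
    using inverse_mult_eq_1'[OF E0] by simp
  also have "fact j * (H * fps_exp (\<omega> u)) $ j = (\<Sum>k\<le>j. fact j / fact (j - k) * \<omega> u ^ (j - k) * H $ k)"
    by (simp add: fps_mult_nth sum_distrib_left atMost_atLeast0 mult_ac)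
  also have "\<dots> = (\<Sum>k\<le>j. falling j k * \<omega> u ^ (j - k) * H $ k)"
  proof (intro sum.cong refl)
    fix k assume "k \<in> {..j}"
    then have "fact j / fact (j - k) = falling j k"
      by (simp add: falling_eq_fact)
    then show "fact j / fact (j - k) * \<omega> u ^ (j - k) * H $ k = falling j k * \<omega> u ^ (j - k) * H $ k" by simp
  qed
  finally show ?thesis unfolding H .
qed

end

theorem theorem6p1:
  fixes s :: "'f::real_normed_field \<Rightarrow> 'v::ab_group_add \<Rightarrow> 'v"
    and S :: "nat \<Rightarrow> ('v \<Rightarrow> 'f) \<Rightarrow> ('f, 'v) tensor \<Rightarrow> 'f"
    and B L :: "('f, 'v, 'v) fts"
    and \<alpha> :: "('f, 'v, 'f) fts"
    and R :: "'v \<Rightarrow> (('v \<Rightarrow> 'f) \<Rightarrow> 'f) \<Rightarrow> ('v \<Rightarrow> 'f) \<Rightarrow> 'f"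
    and \<Phi> :: "'v \<Rightarrow> ('f, 'v, 'v) fts"
    and \<Gamma> :: "'v \<Rightarrow> ('f, 'v, 'f) fts"
  assumes "vector_space s"
    and "sheffer_sequence s S"
    and "B \<in> fts1 s"
    and "\<alpha> \<in> fts s (*)" and "\<alpha> 0 (tensor s []) = 0"
    and "\<forall>\<omega>\<in>dual s. fts_eq s (gen_fun S \<omega>) (fts_exp s (\<lambda>n f. \<omega> (B n f) + \<alpha> n f))"
    and "fts_inverse s B L"
    and "\<And>\<zeta>. raising_operator s S \<zeta> (R \<zeta>)"
    and "\<And>\<zeta>. \<Phi> \<zeta> = fts_comp s (fts_deriv s s B \<zeta>) L"
    and "\<And>\<zeta>. \<Gamma> \<zeta> = fts_comp s (fts_deriv s (*) \<alpha> \<zeta>) L"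
  shows "\<forall>\<zeta>. \<forall>p\<in>polys s. \<forall>\<omega>\<in>dual s.
    R \<zeta> p \<omega> = \<omega> (fts_op s s (\<Phi> \<zeta>) p \<omega>) + fts_op s (*) (\<Gamma> \<zeta>) p \<omega>"
proof (intro allI ballI)
  interpret scalar_space s
    using assms(1) by (simp add: scalar_space_def)
  fix \<zeta> p \<omega>
  assume p: "p \<in> polys s" and \<omega>: "\<omega> \<in> dual s"
  have Bf: "B \<in> fts s s" and Lf: "L \<in> fts s s"
    using assms(3,7) by (auto simp: fts1_def fts_inverse_def)
  have \<Phi>: "\<Phi> \<zeta> \<in> fts s s" unfolding assms(9)
    by (intro fts_comp_mem fts_deriv_mem Bf Lf assms(1))
  have \<Gamma>: "\<Gamma> \<zeta> \<in> fts s (*)" unfolding assms(10)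
    by (intro fts_comp_mem fts_deriv_mem assms(4) Lf vector_space_field)
  have Rl: "R \<zeta> \<in> lin_ops (fscale (*)) (fscale (*)) (polys s) (polys s)"
    using assms(8) by (simp add: raising_operator_def)
  have S: "polynomial_sequence s S"
    using assms(2) by (simp add: sheffer_sequence_def)
  have gen: "fts_eq s (gen_fun S \<omega>) (fts_exp s (\<lambda>n f. \<omega> (B n f) + \<alpha> n f))" if "\<omega> \<in> dual s" for \<omega>
    using assms(6) that by blast
  show "R \<zeta> p \<omega> = \<omega> (fts_op s s (\<Phi> \<zeta>) p \<omega>) + fts_op s (*) (\<Gamma> \<zeta>) p \<omega>"
    using p
  proof (induction rule: polys_induct)
    case zero
    have "R \<zeta> 0 = 0"
      by (rule lin_ops_zero[OF Rl field_fun.vector_space_axioms subspace_polys])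
    from fun_cong[OF this, of \<omega>]
    show "R \<zeta> 0 \<omega> = \<omega> (fts_op s s (\<Phi> \<zeta>) 0 \<omega>) + fts_op s (*) (\<Gamma> \<zeta>) 0 \<omega>"
      unfolding fts_op_0[OF \<Phi> assms(1) \<omega>] fts_op_0[OF \<Gamma> vector_space_field \<omega>]
      by (simp only: zero_fun_apply dual_zero[OF \<omega>] add_0_left)
  next
    case (step c v n q)
    have m: "monomial (tpow s v n) \<in> polys s"
      by (rule monomial_mem[OF tpow_mem])
    have "R \<zeta> (fscale (*) c (monomial (tpow s v n)) + q) =
        fscale (*) c (R \<zeta> (monomial (tpow s v n))) + R \<zeta> q"
      by (simp only: lin_ops_add[OF Rl field_fun.subspace_scale[OF subspace_polys m] step(1)] lin_ops_scale[OF Rl m])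
    then have "R \<zeta> (fscale (*) c (monomial (tpow s v n)) + q) \<omega> = c * R \<zeta> (monomial (tpow s v n)) \<omega> + R \<zeta> q \<omega>"
      by (simp only: plus_fun_apply fscale_def)
    also have "R \<zeta> (monomial (tpow s v n)) \<omega> =
        (\<Sum>k\<le>n. falling n k * \<omega> v ^ (n - k) * (\<omega> (\<Phi> \<zeta> k (tpow s v k)) + \<Gamma> \<zeta> k (tpow s v k)))"
      unfolding assms(9,10)
      by (rule raising_operator_on_powers[OF assms(1) S assms(3-5) gen assms(7,8) \<omega>])
    also have "R \<zeta> q \<omega> = \<omega> (fts_op s s (\<Phi> \<zeta>) q \<omega>) + fts_op s (*) (\<Gamma> \<zeta>) q \<omega>"
      by (rule step.IH)
    finally have "R \<zeta> (fscale (*) c (monomial (tpow s v n)) + q) \<omega> =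
        c * (\<Sum>k\<le>n. falling n k * \<omega> v ^ (n - k) * (\<omega> (\<Phi> \<zeta> k (tpow s v k)) + \<Gamma> \<zeta> k (tpow s v k))) +
        (\<omega> (fts_op s s (\<Phi> \<zeta>) q \<omega>) + fts_op s (*) (\<Gamma> \<zeta>) q \<omega>)" .
    also have "\<dots> =
        \<omega> (fts_op s s (\<Phi> \<zeta>) (fscale (*) c (monomial (tpow s v n)) + q) \<omega>) +
        fts_op s (*) (\<Gamma> \<zeta>) (fscale (*) c (monomial (tpow s v n)) + q) \<omega>"
      unfolding fts_op_combination[OF \<Phi> assms(1) step(1) \<omega>] fts_op_combination[OF \<Gamma> vector_space_field step(1) \<omega>]
      by (simp add: dual_add[OF \<omega>] dual_scale[OF \<omega>] dual_sum[OF \<omega>] distrib_left sum.distrib)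
    finally show "R \<zeta> (fscale (*) c (monomial (tpow s v n)) + q) \<omega> =
        \<omega> (fts_op s s (\<Phi> \<zeta>) (fscale (*) c (monomial (tpow s v n)) + q) \<omega>) +
        fts_op s (*) (\<Gamma> \<zeta>) (fscale (*) c (monomial (tpow s v n)) + q) \<omega>" .
  qed
qed

end
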